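(* Let $M\colon 0\to n$ be a string diagram of $\mathsf{GQA}$. Then there exist a string diagram $M'\colon 0\to n$ built only from the generators copy, discard, addition, zero, scalars, one, $N$ and the black unit $\eta_\bullet$ (i.e. a diagram of the subprop $\overrightarrow{\mathsf{GQA}}_E$), and a scalar diagram $\alpha\colon 0\to 0$, such that $M = M'\oplus\alpha$ is derivable in $\mathsf{GQA}$, where $\alpha$ is either of the form $\mathbf 1;c;N^{op}$ for some $c\in[0,\infty)$, or $\alpha=\mathbf 1;\epsilon_\circ$ (the scalar $\infty$).
   Context: A prop is a symmetric strict monoidal category whose objects are the natural numbers with monoidal product on objects given by addition. The prop $\mathsf{GQA}$ (Graphical Quadratic Algebra) is freely generated (string diagrams built by sequential composition $;$ and parallel composition $\oplus$ from generators, identities and symmetries, modulo symmetric strict monoidal category laws, quotiented by the congruence generated by the equations) by the generators: copy (black comultiplication) $\delta\colon1\to2$, discard (black counit) $\epsilon\colon1\to0$, black multiplication $\mu_\bullet\colon 2\to1$, black unit $\eta_\bullet\colon0\to1$, addition (white multiplication) $\mu\colon2\to1$, zero (white unit) $\eta\colon0\to1$, white comultiplication $\delta_\circ\colon1\to2$, white counit $\epsilon_\circ\colon 1\to 0$, scalars $k\colon1\to1$ ($k\in\mathbb R$), one $\mathbf 1\colon0\to1$, and $N\colon0\to1$; with equations: (E) every equation $s=t$ between $N$-free diagrams having the same interpretation as affine relations (the interpretations below; equivalently the axioms of Graphical Affine Algebra, complete for affine relations); (D) $N;\epsilon=\mathrm{id}_0$; (Z) $N;\epsilon_\circ=\mathrm{id}_0$;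 (RI) for each $\varphi\in[0,2\pi)$, $(N\oplus N);R_\varphi=N\oplus N$ where $R_\varphi\colon2\to2$ is an $N$-free diagram built from copy, addition and scalars interpreting the rotation matrix $\begin{pmatrix}\cos\varphi&-\sin\varphi\\ \sin\varphi&\cos\varphi\end{pmatrix}$. Interpretations (as weighted relations $\mathbb R^m\times\mathbb R^n\to[0,\infty]$, writing $[\phi]=0$ if $\phi$ holds and $\infty$ otherwise): copy $[x=x_1=x_2]$, discard $0$, black multiplication $[x_1=x_2=x]$, black unit $0$, addition $[y=x_1+x_2]$, zero $[x=0]$, white comultiplication $[x=y_1+y_2]$, white counit $[x=0]$, scalar $k$: $[y=kx]$, one $[x=1]$, $N$: $x\mapsto\frac12x^2$; composition is $(F;G)(x,z)=\inf_y F(x,y)+G(y,z)$ and $\oplus$ is addition of weights. The mirror image of $N$ is $N^{op}\colon1\to0$, $N^{op}:=(\mathrm{id}_1\oplus N);\mu_\bullet;\epsilon$, interpreted as $x\mapsto\frac12x^2$. *)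

theory Defs
  imports Complex_Main "HOL-Library.Extended_Nonnegative_Real"
begin

section \<open>Prop terms over a signature\<close>

text \<open>String diagrams are represented by terms; the laws of symmetric strict monoidal
  categories are part of the derivability relation below. \<open>Sym m n\<close> is the symmetry
  \<open>m + n \<rightarrow> n + m\<close>; \<open>gens d\<close> is the set of generators occurring in \<open>d\<close>.\<close>

datatype (gens: 'g) diag =
    Gen 'g
  | Id nat
  | Sym nat nat
  | Seq "'g diag" "'g diag"  (infixl ";;" 65)
  | Par "'g diag" "'g diag"  (infixr "\<oplus>" 75)

datatype gen =
    Copy | Discard | BMult | BUnit
  | Add | Zero | WComult | WCounit
  | Scalar real | One | NGen

primrec gen_src :: "gen \<Rightarrow> nat" where
  "gen_src Copy = 1"
| "gen_src Discard = 1"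
| "gen_src BMult = 2"
| "gen_src BUnit = 0"
| "gen_src Add = 2"
| "gen_src Zero = 0"
| "gen_src WComult = 1"
| "gen_src WCounit = 1"
| "gen_src (Scalar k) = 1"
| "gen_src One = 0"
| "gen_src NGen = 0"

primrec gen_tgt :: "gen \<Rightarrow> nat" where
  "gen_tgt Copy = 2"
| "gen_tgt Discard = 0"
| "gen_tgt BMult = 1"
| "gen_tgt BUnit = 1"
| "gen_tgt Add = 1"
| "gen_tgt Zero = 1"
| "gen_tgt WComult = 2"
| "gen_tgt WCounit = 0"
| "gen_tgt (Scalar k) = 1"
| "gen_tgt One = 1"
| "gen_tgt NGen = 1"

primrec src :: "gen diag \<Rightarrow> nat" where
  "src (Gen g) = gen_src g"
| "src (Id n) = n"
| "src (Sym m n) = m + n"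
| "src (f ;; g) = src f"
| "src (f \<oplus> g) = src f + src g"

primrec tgt :: "gen diag \<Rightarrow> nat" where
  "tgt (Gen g) = gen_tgt g"
| "tgt (Id n) = n"
| "tgt (Sym m n) = n + m"
| "tgt (f ;; g) = tgt g"
| "tgt (f \<oplus> g) = tgt f + tgt g"

primrec wf_diag :: "gen diag \<Rightarrow> bool" where
  "wf_diag (Gen g) \<longleftrightarrow> True"
| "wf_diag (Id n) \<longleftrightarrow> True"
| "wf_diag (Sym m n) \<longleftrightarrow> True"
| "wf_diag (f ;; g) \<longleftrightarrow> wf_diag f \<and> wf_diag g \<and> tgt f = src g"
| "wf_diag (f \<oplus> g) \<longleftrightarrow> wf_diag f \<and> wf_diag g"

definition diags :: "nat \<Rightarrow> nat \<Rightarrow> gen diag set" where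
  "diags m n = {d. wf_diag d \<and> src d = m \<and> tgt d = n}"


section \<open>Interpretation as weighted relations\<close>

text \<open>A point of \<open>\<real>\<^sup>m\<close> is a list of length \<open>m\<close>. The value of the interpretation of
  \<open>d \<in> diags m n\<close> on lists of other lengths is junk and is never used.\<close>

definition constr :: "bool \<Rightarrow> ennreal" where
  "constr P = (if P then 0 else \<infinity>)"

primrec gen_interp :: "gen \<Rightarrow> real list \<Rightarrow> real list \<Rightarrow> ennreal" where
  "gen_interp Copy x y = constr (x ! 0 = y ! 0 \<and> x ! 0 = y ! 1)"
| "gen_interp Discard x y = 0"
| "gen_interp BMult x y = constr (x ! 0 = y ! 0 \<and> x ! 1 = y ! 0)"
| "gen_interp BUnit x y = 0"
| "gen_interp Add x y = constr (y ! 0 = x ! 0 + x ! 1)"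
| "gen_interp Zero x y = constr (y ! 0 = 0)"
| "gen_interp WComult x y = constr (x ! 0 = y ! 0 + y ! 1)"
| "gen_interp WCounit x y = constr (x ! 0 = 0)"
| "gen_interp (Scalar k) x y = constr (y ! 0 = k * x ! 0)"
| "gen_interp One x y = constr (y ! 0 = 1)"
| "gen_interp NGen x y = ennreal ((y ! 0)\<^sup>2 / 2)"

primrec interp :: "gen diag \<Rightarrow> real list \<Rightarrow> real list \<Rightarrow> ennreal" where
  "interp (Gen g) x y = gen_interp g x y"
| "interp (Id n) x y = constr (y = x)"
| "interp (Sym m n) x y = constr (y = drop m x @ take m x)"
| "interp (f ;; g) x z = (INF y\<in>{y. length y = tgt f}. interp f x y + interp g y z)"
| "interp (f \<oplus> g) x y =
     interp f (take (src f) x) (take (tgt f) y) + interp g (drop (src f) x) (drop (tgt f) y)"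

text \<open>For \<open>d\<close> without \<open>NGen\<close> this takes only the values \<open>0\<close> and \<open>\<infinity>\<close>, and is
  \<open>constr\<close> of the affine relation denoted by \<open>d\<close>.\<close>


section \<open>Graphical Quadratic Algebra\<close>

definition rot :: "real \<Rightarrow> gen diag" where
  "rot \<phi> =
     Gen Copy \<oplus> Gen Copy ;;
     Id 1 \<oplus> Sym 1 1 \<oplus> Id 1 ;;
     (Gen (Scalar (cos \<phi>)) \<oplus> Gen (Scalar (- sin \<phi>))) \<oplus>
       (Gen (Scalar (sin \<phi>)) \<oplus> Gen (Scalar (cos \<phi>))) ;;
     Gen Add \<oplus> Gen Add"

text \<open>Only well-formed terms of the same type are related. The unit law
  \<open>Sym m 0 = Id m\<close> follows from \<open>sym_hexagon\<close> and \<open>sym_inverse\<close>.\<close>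

inductive gqa_eq :: "gen diag \<Rightarrow> gen diag \<Rightarrow> bool"  (infix "\<doteq>" 50) where
  refl: "wf_diag f \<Longrightarrow> f \<doteq> f"
| symm: "f \<doteq> g \<Longrightarrow> g \<doteq> f"
| trans: "f \<doteq> g \<Longrightarrow> g \<doteq> h \<Longrightarrow> f \<doteq> h"
| cong_seq: "f \<doteq> f' \<Longrightarrow> g \<doteq> g' \<Longrightarrow> tgt f = src g \<Longrightarrow> f ;; g \<doteq> f' ;; g'"
| cong_par: "f \<doteq> f' \<Longrightarrow> g \<doteq> g' \<Longrightarrow> f \<oplus> g \<doteq> f' \<oplus> g'"
| seq_assoc: "wf_diag (f ;; g ;; h) \<Longrightarrow> f ;; g ;; h \<doteq> f ;; (g ;; h)"
| seq_id_left: "wf_diag f \<Longrightarrow> Id (src f) ;; f \<doteq> f"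
| seq_id_right: "wf_diag f \<Longrightarrow> f ;; Id (tgt f) \<doteq> f"
| par_assoc: "wf_diag f \<Longrightarrow> wf_diag g \<Longrightarrow> wf_diag h \<Longrightarrow> (f \<oplus> g) \<oplus> h \<doteq> f \<oplus> (g \<oplus> h)"
| par_unit_left: "wf_diag f \<Longrightarrow> Id 0 \<oplus> f \<doteq> f"
| par_unit_right: "wf_diag f \<Longrightarrow> f \<oplus> Id 0 \<doteq> f"
| par_id: "Id m \<oplus> Id n \<doteq> Id (m + n)"
| interchange: "wf_diag (f ;; g) \<Longrightarrow> wf_diag (h ;; k) \<Longrightarrow>
    (f ;; g) \<oplus> (h ;; k) \<doteq> (f \<oplus> h) ;; (g \<oplus> k)"
| sym_natural: "wf_diag f \<Longrightarrow> wf_diag g \<Longrightarrow>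
    (f \<oplus> g) ;; Sym (tgt f) (tgt g) \<doteq> Sym (src f) (src g) ;; (g \<oplus> f)"
| sym_inverse: "Sym m n ;; Sym n m \<doteq> Id (m + n)"
| sym_hexagon: "Sym m (n + k) \<doteq> (Sym m n \<oplus> Id k) ;; (Id n \<oplus> Sym m k)"
| E: "s \<in> diags m n \<Longrightarrow> t \<in> diags m n \<Longrightarrow> NGen \<notin> gens s \<Longrightarrow> NGen \<notin> gens t \<Longrightarrow>
    (\<And>x y. length x = m \<Longrightarrow> length y = n \<Longrightarrow> interp s x y = interp t x y) \<Longrightarrow> s \<doteq> t"
| D: "Gen NGen ;; Gen Discard \<doteq> Id 0"
| Z: "Gen NGen ;; Gen WCounit \<doteq> Id 0"
| RI: "0 \<le> \<phi> \<Longrightarrow> \<phi> < 2 * pi \<Longrightarrow>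
    (Gen NGen \<oplus> Gen NGen) ;; rot \<phi> \<doteq> Gen NGen \<oplus> Gen NGen"

definition N_op :: "gen diag" where
  "N_op = (Id 1 \<oplus> Gen NGen) ;; Gen BMult ;; Gen Discard"

text \<open>The generators of the subprop of diagrams directed from left to right, extended
  with the black unit.\<close>

definition GQA_E_gens :: "gen set" where
  "GQA_E_gens = {Copy, Discard, Add, Zero, One, NGen, BUnit} \<union> range Scalar"


section \<open>Sanity checks\<close>

lemma gqa_eq_typed:
  "f \<doteq> g \<Longrightarrow> wf_diag f \<and> wf_diag g \<and> src f = src g \<and> tgt f = tgt g"
  by (induction rule: gqa_eq.induct) (auto simp: diags_def rot_def)

lemma rot_typed: "rot \<phi> \<in> diags 2 2"
  by (simp add: diags_def rot_def)

lemma N_op_typed: "N_op \<in> diags 1 0"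
  by (simp add: diags_def N_op_def)

lemma INF_constr:
  assumes "b \<in> A" "\<And>y. y \<in> A \<Longrightarrow> f y = constr (y = b)"
  shows "(INF y\<in>A. f y + g y) = (g b :: ennreal)"
proof (rule antisym)
  show "(INF y\<in>A. f y + g y) \<le> g b"
    using assms by (intro INF_lower2[of b]) (auto simp: constr_def)
  show "g b \<le> (INF y\<in>A. f y + g y)"
    using assms by (intro INF_greatest) (auto simp: constr_def)
qed

lemma constr_add: "constr P + constr Q = constr (P \<and> Q)"
  by (simp add: constr_def)

lemma list4_conv: "length y = 4 \<longleftrightarrow> (\<exists>a b c d. y = [a, b, c, d])"
  by (auto simp: numeral_eq_Suc length_Suc_conv)

lemma rot_interp:
  "interp (rot \<phi>) [x1, x2] [y1, y2] =
     constr (y1 = cos \<phi> * x1 - sin \<phi> * x2 \<and> y2 = sin \<phi> * x1 + cos \<phi> * x2)"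
proof -
  let ?A = "Gen Copy \<oplus> Gen Copy" and ?B = "Id 1 \<oplus> Sym 1 1 \<oplus> Id 1 :: gen diag"
  let ?C = "(Gen (Scalar (cos \<phi>)) \<oplus> Gen (Scalar (- sin \<phi>))) \<oplus>
       (Gen (Scalar (sin \<phi>)) \<oplus> Gen (Scalar (cos \<phi>)))"
  have A: "interp ?A [x1, x2] y = constr (y = [x1, x1, x2, x2])" if "length y = 4" for y
    using that unfolding list4_conv by (auto simp: constr_add numeral_eq_Suc intro!: arg_cong[of _ _ constr])
  have B: "interp (?A ;; ?B) [x1, x2] y = constr (y = [x1, x2, x1, x2])" if "length y = 4" for y
  proof -
    have "interp (?A ;; ?B) [x1, x2] y = interp ?B [x1, x1, x2, x2] y"
      unfolding interp.simps(4) by (rule INF_constr) (use A in auto)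
    also have "\<dots> = constr (y = [x1, x2, x1, x2])"
      using that unfolding list4_conv by (auto simp: constr_add numeral_eq_Suc intro!: arg_cong[of _ _ constr])
    finally show ?thesis .
  qed
  have C: "interp (?A ;; ?B ;; ?C) [x1, x2] y =
      constr (y = [cos \<phi> * x1, - sin \<phi> * x2, sin \<phi> * x1, cos \<phi> * x2])" if "length y = 4" for y
  proof -
    have "interp (?A ;; ?B ;; ?C) [x1, x2] y = interp ?C [x1, x2, x1, x2] y"
      unfolding interp.simps(4)[of "?A ;; ?B"] by (rule INF_constr) (use B in auto)
    also have "\<dots> = constr (y = [cos \<phi> * x1, - sin \<phi> * x2, sin \<phi> * x1, cos \<phi> * x2])"
      using that unfolding list4_conv by (auto simp: constr_add numeral_eq_Suc intro!: arg_cong[of _ _ constr])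
    finally show ?thesis .
  qed
  have "interp (rot \<phi>) [x1, x2] [y1, y2] =
      interp (Gen Add \<oplus> Gen Add) [cos \<phi> * x1, - sin \<phi> * x2, sin \<phi> * x1, cos \<phi> * x2] [y1, y2]"
    unfolding rot_def interp.simps(4)[of "?A ;; ?B ;; ?C"]
    by (rule INF_constr) (use C in auto)
  also have "\<dots> = constr (y1 = cos \<phi> * x1 - sin \<phi> * x2 \<and> y2 = sin \<phi> * x1 + cos \<phi> * x2)"
    by (simp add: constr_add numeral_eq_Suc)
  finally show ?thesis .
qed

end

theory Submission
  imports Defs
begin

text \<open>Sliding every \<open>NGen\<close> to the front turns the diagram into \<open>Npow k ;; s\<close> with \<open>s\<close> free
  of \<open>NGen\<close>, so that \<open>s\<close> may be rewritten freely along equality of affine relations. Such a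
  relation is presented as the image \<open>z = F (y @ x)\<close> of an affine map with unconstrained hidden
  variables \<open>y\<close>, subject to finitely many affine equations, which are removed one at a time. An
  equation that mentions a hidden variable is solved for it. An equation in the inputs \<open>x\<close> alone
  becomes, after rotating the Gaussians, \<open>r * x\<^sub>0 + \<gamma> = 0\<close>: for \<open>r \<noteq> 0\<close> it pins a single Gaussian
  to the point \<open>- \<gamma> / r\<close> and splits off a scalar, and for \<open>r = 0\<close> it is either void or
  contradictory. Once no equation is left, the hidden variables are black units and \<open>F\<close> is a
  directed diagram. Two scalars fuse by rotating the pair of points \<open>(a, b)\<close> to \<open>(r, 0)\<close>, where
  \<open>r\<^sup>2 = a\<^sup>2 + b\<^sup>2\<close>; this also makes the constant nonnegative.\<close>

section \<open>Equational reasoning in a prop\<close>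

declare gqa_eq.trans [trans]

lemma cong_seq_left: "f \<doteq> f' \<Longrightarrow> wf_diag g \<Longrightarrow> tgt f = src g \<Longrightarrow> f ;; g \<doteq> f' ;; g"
  by (rule gqa_eq.cong_seq) (auto intro: gqa_eq.refl)

lemma cong_seq_right: "g \<doteq> g' \<Longrightarrow> wf_diag f \<Longrightarrow> tgt f = src g \<Longrightarrow> f ;; g \<doteq> f ;; g'"
  by (rule gqa_eq.cong_seq) (auto intro: gqa_eq.refl)

lemma cong_par_left: "f \<doteq> f' \<Longrightarrow> wf_diag g \<Longrightarrow> f \<oplus> g \<doteq> f' \<oplus> g"
  by (rule gqa_eq.cong_par) (auto intro: gqa_eq.refl)

lemma cong_par_right: "g \<doteq> g' \<Longrightarrow> wf_diag f \<Longrightarrow> f \<oplus> g \<doteq> f \<oplus> g'"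
  by (rule gqa_eq.cong_par) (auto intro: gqa_eq.refl)

lemma eq_id_seq: "wf_diag f \<Longrightarrow> src f = m \<Longrightarrow> f \<doteq> Id m ;; f"
  by (metis gqa_eq.seq_id_left gqa_eq.symm)

lemma eq_seq_id: "wf_diag f \<Longrightarrow> tgt f = m \<Longrightarrow> f \<doteq> f ;; Id m"
  by (metis gqa_eq.seq_id_right gqa_eq.symm)

lemma par_eq_seq_left_first:
  assumes "wf_diag f" "wf_diag g"
  shows "f \<oplus> g \<doteq> (f \<oplus> Id (src g)) ;; (Id (tgt f) \<oplus> g)"
proof -
  have "f \<oplus> g \<doteq> (f ;; Id (tgt f)) \<oplus> (Id (src g) ;; g)"
    using assms by (intro gqa_eq.cong_par eq_id_seq eq_seq_id) auto
  also have "\<dots> \<doteq> (f \<oplus> Id (src g)) ;; (Id (tgt f) \<oplus> g)"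
    using assms by (intro gqa_eq.interchange) auto
  finally show ?thesis .
qed

lemma par_eq_seq_right_first:
  assumes "wf_diag f" "wf_diag g"
  shows "f \<oplus> g \<doteq> (Id (src f) \<oplus> g) ;; (f \<oplus> Id (tgt g))"
proof -
  have "f \<oplus> g \<doteq> (Id (src f) ;; f) \<oplus> (g ;; Id (tgt g))"
    using assms by (intro gqa_eq.cong_par eq_id_seq eq_seq_id) auto
  also have "\<dots> \<doteq> (Id (src f) \<oplus> g) ;; (f \<oplus> Id (tgt g))"
    using assms by (intro gqa_eq.interchange) auto
  finally show ?thesis .
qed

text \<open>Both sides reduce to \<open>a \<oplus> f\<close>, executed in either order. Without
  inputs, \<open>a\<close> slides freely past \<open>f\<close>: this brings Gaussians to the front
  and later exchanges a constant with a Gaussian.\<close>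

lemma state_par_seq:
  assumes "wf_diag a" "src a = 0" "wf_diag f"
  shows "f ;; (a \<oplus> Id (tgt f)) \<doteq> (a \<oplus> Id (src f)) ;; (Id (tgt a) \<oplus> f)"
proof -
  have "f ;; (a \<oplus> Id (tgt f)) \<doteq> (Id 0 \<oplus> f) ;; (a \<oplus> Id (tgt f))"
    using assms by (intro cong_seq_left gqa_eq.symm[OF gqa_eq.par_unit_left]) auto
  also have "\<dots> \<doteq> a \<oplus> f"
    using gqa_eq.symm[OF par_eq_seq_right_first[of a f]] assms by auto
  also have "\<dots> \<doteq> (a \<oplus> Id (src f)) ;; (Id (tgt a) \<oplus> f)"
    using assms by (intro par_eq_seq_left_first)
  finally show ?thesis .
qed


section \<open>Relational semantics of the affine fragment\<close>

text \<open>Relational counterpart of the weights 0 and \<infinity>. The clause for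
  \<open>NGen\<close> is a placeholder: relations are compared with weights only for
  \<open>NGen\<close>-free diagrams.\<close>

primrec gen_rel :: "gen \<Rightarrow> real list \<Rightarrow> real list \<Rightarrow> bool" where
  "gen_rel Copy x y \<longleftrightarrow> x ! 0 = y ! 0 \<and> x ! 0 = y ! 1"
| "gen_rel Discard x y \<longleftrightarrow> True"
| "gen_rel BMult x y \<longleftrightarrow> x ! 0 = y ! 0 \<and> x ! 1 = y ! 0"
| "gen_rel BUnit x y \<longleftrightarrow> True"
| "gen_rel Add x y \<longleftrightarrow> y ! 0 = x ! 0 + x ! 1"
| "gen_rel Zero x y \<longleftrightarrow> y ! 0 = 0"
| "gen_rel WComult x y \<longleftrightarrow> x ! 0 = y ! 0 + y ! 1"
| "gen_rel WCounit x y \<longleftrightarrow> x ! 0 = 0"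
| "gen_rel (Scalar k) x y \<longleftrightarrow> y ! 0 = k * x ! 0"
| "gen_rel One x y \<longleftrightarrow> y ! 0 = 1"
| "gen_rel NGen x y \<longleftrightarrow> True"

primrec rel :: "gen diag \<Rightarrow> real list \<Rightarrow> real list \<Rightarrow> bool" where
  "rel (Gen g) x y \<longleftrightarrow> gen_rel g x y"
| "rel (Id n) x y \<longleftrightarrow> y = x"
| "rel (Sym m n) x y \<longleftrightarrow> y = drop m x @ take m x"
| "rel (f ;; g) x z \<longleftrightarrow> (\<exists>y. length y = tgt f \<and> rel f x y \<and> rel g y z)"
| "rel (f \<oplus> g) x y \<longleftrightarrow>
     rel f (take (src f) x) (take (tgt f) y) \<and> rel g (drop (src f) x) (drop (tgt f) y)"

text \<open>An infimum of weights 0 and \<infinity> is 0 exactly when some term is 0, and an empty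
  infimum is \<infinity>. Hence composition of weighted relations restricts to relational
  composition.\<close>

lemma INF_constr_Ex: "(INF y\<in>A. constr (P y)) = constr (\<exists>y\<in>A. P y)"
proof (cases "\<exists>y\<in>A. P y")
  case True
  then obtain y where y: "y \<in> A" "P y" by blast
  then have "(INF y\<in>A. constr (P y)) \<le> 0"
    by (intro INF_lower2[of y]) (auto simp: constr_def)
  with True show ?thesis
    by (simp add: constr_def)
next
  case False
  then have "(INF y\<in>A. constr (P y)) = (INF y\<in>A. \<infinity>)"
    by (intro INF_cong) (auto simp: constr_def)
  with False show ?thesis
    by (cases "A = {}") (auto simp: constr_def)
qed

lemma interp_eq_constr_rel: "NGen \<notin> gens d \<Longrightarrow> interp d x y = constr (rel d x y)"
proof (induction d arbitrary: x y)
  case (Gen g)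
  then show ?case by (cases g) (auto simp: constr_def)
next
  case (Seq f g)
  then have "interp (f ;; g) x y
      = (INF z\<in>{z. length z = tgt f}. constr (rel f x z \<and> rel g z y))"
    by (simp add: constr_add)
  then show ?case by (simp add: INF_constr_Ex)
qed (auto simp: constr_add)

definition affine_diags :: "nat \<Rightarrow> nat \<Rightarrow> gen diag set" where
  "affine_diags m n = {d \<in> diags m n. NGen \<notin> gens d}"

text \<open>Axiom \<open>E\<close> with weights replaced by relations: the bridge by which semantic
  reasoning about \<open>NGen\<close>-free diagrams yields derivable equations.\<close>

lemma affine_diags_eqI:
  assumes "s \<in> affine_diags m n" "t \<in> affine_diags m n"
    and "\<And>x y. length x = m \<Longrightarrow> length y = n \<Longrightarrow> rel s x y \<longleftrightarrow> rel t x y"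
  shows "s \<doteq> t"
  using assms by (intro gqa_eq.E[of s m n t]) (auto simp: affine_diags_def interp_eq_constr_rel)

lemma sym_0_left: "Sym 0 n \<doteq> Id n"
  by (rule affine_diags_eqI[of _ n n]) (auto simp: affine_diags_def diags_def)

text \<open>Naturality of the symmetry, whose components \<open>Sym 0 n\<close> and
  \<open>Sym 0 0\<close> are identities.\<close>

lemma scalar_par_commute:
  assumes "\<alpha> \<in> diags 0 0" "M \<in> diags 0 n"
  shows "\<alpha> \<oplus> M \<doteq> M \<oplus> \<alpha>"
proof -
  have wf: "wf_diag \<alpha>" "wf_diag M" "src \<alpha> = 0" "tgt \<alpha> = 0" "src M = 0" "tgt M = n"
    using assms by (auto simp: diags_def)
  have "\<alpha> \<oplus> M \<doteq> (\<alpha> \<oplus> M) ;; Id n"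
    using wf by (intro eq_seq_id) auto
  also have "\<dots> \<doteq> (\<alpha> \<oplus> M) ;; Sym 0 n"
    using wf by (intro cong_seq_right gqa_eq.symm[OF sym_0_left]) auto
  also have "\<dots> \<doteq> Sym 0 0 ;; (M \<oplus> \<alpha>)"
    using gqa_eq.sym_natural[of \<alpha> M] wf by auto
  also have "\<dots> \<doteq> Id 0 ;; (M \<oplus> \<alpha>)"
    using wf by (intro cong_seq_left sym_0_left) auto
  also have "\<dots> \<doteq> M \<oplus> \<alpha>"
    using gqa_eq.seq_id_left[of "M \<oplus> \<alpha>"] wf by auto
  finally show ?thesis .
qed


section \<open>Moving Gaussians to the front\<close>

primrec Npow :: "nat \<Rightarrow> gen diag" where
  "Npow 0 = Id 0"
| "Npow (Suc k) = Gen NGen \<oplus> Npow k"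

lemma Npow_typed [simp]: "wf_diag (Npow k)" "src (Npow k) = 0" "tgt (Npow k) = k"
  by (induction k) auto

lemma gens_Npow [simp]: "gens (Npow k) \<subseteq> GQA_E_gens"
  by (induction k) (auto simp: GQA_E_gens_def)

lemma Npow_add: "Npow k \<oplus> Npow l \<doteq> Npow (k + l)"
proof (induction k)
  case 0
  then show ?case by (simp add: gqa_eq.par_unit_left)
next
  case (Suc k)
  have "(Gen NGen \<oplus> Npow k) \<oplus> Npow l \<doteq> Gen NGen \<oplus> (Npow k \<oplus> Npow l)"
    by (rule gqa_eq.par_assoc) auto
  also have "\<dots> \<doteq> Gen NGen \<oplus> Npow (k + l)"
    using Suc by (intro cong_par_right) auto
  finally show ?case by simp
qed

lemma Npow_par_Id_seq: "(Npow k \<oplus> Id m) ;; (Npow l \<oplus> Id (k + m)) \<doteq> Npow (l + k) \<oplus> Id m"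
proof -
  have "(Npow k \<oplus> Id m) ;; (Npow l \<oplus> Id (k + m))
      \<doteq> (Npow l \<oplus> Id m) ;; (Id l \<oplus> (Npow k \<oplus> Id m))"
    using state_par_seq[of "Npow l" "Npow k \<oplus> Id m"] by simp
  also have "\<dots> \<doteq> Npow l \<oplus> (Npow k \<oplus> Id m)"
    using gqa_eq.symm[OF par_eq_seq_left_first[of "Npow l" "Npow k \<oplus> Id m"]] by auto
  also have "\<dots> \<doteq> (Npow l \<oplus> Npow k) \<oplus> Id m"
    by (intro gqa_eq.symm[OF gqa_eq.par_assoc]) auto
  also have "\<dots> \<doteq> Npow (l + k) \<oplus> Id m"
    by (intro cong_par_left Npow_add) auto
  finally show ?thesis .
qed

text \<open>Naturality again, with \<open>Sym 0 m\<close> trivial: Gaussians pass to the left of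
  \<open>m\<close> wires at the cost of an \<open>NGen\<close>-free permutation.\<close>

lemma Id_par_Npow: "Id m \<oplus> Npow l \<doteq> (Npow l \<oplus> Id m) ;; Sym l m"
proof -
  have "(Npow l \<oplus> Id m) ;; Sym l m \<doteq> Sym 0 m ;; (Id m \<oplus> Npow l)"
    using gqa_eq.sym_natural[of "Npow l" "Id m"] by simp
  also have "\<dots> \<doteq> Id m ;; (Id m \<oplus> Npow l)"
    by (intro cong_seq_left sym_0_left) auto
  also have "\<dots> \<doteq> Id m \<oplus> Npow l"
    using gqa_eq.seq_id_left[of "Id m \<oplus> Npow l"] by auto
  finally show ?thesis by (rule gqa_eq.symm)
qed

text \<open>Gathering both groups of Gaussians on the left displaces the \<open>m\<close> inputs;
  \<open>Sym l m\<close> puts them back and, being \<open>NGen\<close>-free, can join the affine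
  part.\<close>

lemma Npow_par_shuffle:
  "(Npow k \<oplus> Id m) \<oplus> (Npow l \<oplus> Id p)
    \<doteq> (Npow (k + l) \<oplus> Id (m + p)) ;; (Id k \<oplus> (Sym l m \<oplus> Id p))"
proof -
  have A: "Id m \<oplus> (Npow l \<oplus> Id p) \<doteq> (Npow l \<oplus> Id (m + p)) ;; (Sym l m \<oplus> Id p)"
  proof -
    have "Id m \<oplus> (Npow l \<oplus> Id p) \<doteq> (Id m \<oplus> Npow l) \<oplus> Id p"
      by (intro gqa_eq.symm[OF gqa_eq.par_assoc]) auto
    also have "\<dots> \<doteq> ((Npow l \<oplus> Id m) ;; Sym l m) \<oplus> (Id p ;; Id p)"
      by (intro gqa_eq.cong_par Id_par_Npow eq_seq_id) auto
    also have "\<dots> \<doteq> ((Npow l \<oplus> Id m) \<oplus> Id p) ;; (Sym l m \<oplus> Id p)"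
      by (intro gqa_eq.interchange) auto
    also have "\<dots> \<doteq> (Npow l \<oplus> (Id m \<oplus> Id p)) ;; (Sym l m \<oplus> Id p)"
      by (intro cong_seq_left gqa_eq.par_assoc) auto
    also have "\<dots> \<doteq> (Npow l \<oplus> Id (m + p)) ;; (Sym l m \<oplus> Id p)"
      by (intro cong_seq_left cong_par_right gqa_eq.par_id) auto
    finally show ?thesis .
  qed
  have "(Npow k \<oplus> Id m) \<oplus> (Npow l \<oplus> Id p) \<doteq> Npow k \<oplus> (Id m \<oplus> (Npow l \<oplus> Id p))"
    by (intro gqa_eq.par_assoc) auto
  also have "\<dots> \<doteq> (Npow k ;; Id k) \<oplus> ((Npow l \<oplus> Id (m + p)) ;; (Sym l m \<oplus> Id p))"
    by (intro gqa_eq.cong_par A eq_seq_id) auto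
  also have "\<dots> \<doteq> (Npow k \<oplus> (Npow l \<oplus> Id (m + p))) ;; (Id k \<oplus> (Sym l m \<oplus> Id p))"
    by (intro gqa_eq.interchange) auto
  also have "\<dots> \<doteq> ((Npow k \<oplus> Npow l) \<oplus> Id (m + p)) ;; (Id k \<oplus> (Sym l m \<oplus> Id p))"
    by (intro cong_seq_left gqa_eq.symm[OF gqa_eq.par_assoc]) auto
  also have "\<dots> \<doteq> (Npow (k + l) \<oplus> Id (m + p)) ;; (Id k \<oplus> (Sym l m \<oplus> Id p))"
    by (intro cong_seq_left cong_par_left Npow_add) auto
  finally show ?thesis .
qed

lemma affine_eq_Npow_seq:
  assumes "s \<in> affine_diags m n"
  shows "s \<doteq> (Npow 0 \<oplus> Id m) ;; s"
proof -
  have wf: "wf_diag s" "src s = m" using assms by (auto simp: affine_diags_def diags_def)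
  have "s \<doteq> Id m ;; s"
    using wf by (intro eq_id_seq) auto
  also have "\<dots> \<doteq> (Npow 0 \<oplus> Id m) ;; s"
    using wf gqa_eq.symm[OF gqa_eq.par_unit_left[of "Id m"]] by (intro cong_seq_left) auto
  finally show ?thesis .
qed

text \<open>Structural induction passes through diagrams with inputs, hence the wires
  \<open>Id (src d)\<close> beside the Gaussians. All wiring created on the way is absorbed into
  \<open>s\<close>.\<close>

lemma Npow_form:
  "wf_diag d \<Longrightarrow> \<exists>k. \<exists>s \<in> affine_diags (k + src d) (tgt d). d \<doteq> (Npow k \<oplus> Id (src d)) ;; s"
proof (induction d)
  case (Gen g)
  show ?case
  proof (cases "g = NGen")
    case True
    have "Gen NGen \<doteq> Gen NGen ;; Id 1"
      by (intro eq_seq_id) auto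
    also have "\<dots> \<doteq> (Gen NGen \<oplus> Id 0) ;; Id 1"
      by (intro cong_seq_left gqa_eq.symm[OF gqa_eq.par_unit_right]) auto
    also have "\<dots> \<doteq> ((Gen NGen \<oplus> Id 0) \<oplus> Id 0) ;; Id 1"
      by (intro cong_seq_left gqa_eq.symm[OF gqa_eq.par_unit_right]) auto
    finally have "Gen NGen \<doteq> (Npow 1 \<oplus> Id 0) ;; Id 1" by simp
    with True show ?thesis
      by (intro exI[of _ 1] bexI[of _ "Id 1"]) (auto simp: affine_diags_def diags_def)
  next
    case False
    with affine_eq_Npow_seq[of "Gen g" "gen_src g" "gen_tgt g"] show ?thesis
      by (intro exI[of _ 0] bexI[of _ "Gen g"]) (auto simp: affine_diags_def diags_def)
  qed
next
  case (Id n)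
  with affine_eq_Npow_seq[of "Id n" n n] show ?case
    by (intro exI[of _ 0] bexI[of _ "Id n"]) (auto simp: affine_diags_def diags_def)
next
  case (Sym m n)
  with affine_eq_Npow_seq[of "Sym m n" "m + n" "n + m"] show ?case
    by (intro exI[of _ 0] bexI[of _ "Sym m n"]) (auto simp: affine_diags_def diags_def)
next
  case (Seq f g)
  let ?m = "src f" and ?p = "tgt f"
  have wf: "wf_diag f" "wf_diag g" "src g = ?p" using Seq.prems by auto
  obtain k s where s: "s \<in> affine_diags (k + ?m) ?p" "f \<doteq> (Npow k \<oplus> Id ?m) ;; s"
    using Seq.IH(1) wf by auto
  obtain l t where t: "t \<in> affine_diags (l + ?p) (tgt g)" "g \<doteq> (Npow l \<oplus> Id ?p) ;; t"
    using Seq.IH(2) wf by auto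
  have ws: "wf_diag s" "src s = k + ?m" "tgt s = ?p"
    and wt: "wf_diag t" "src t = l + ?p" "tgt t = tgt g"
    using s t by (auto simp: affine_diags_def diags_def)
  note [simp] = wf ws wt
  let ?P = "Npow k \<oplus> Id ?m" and ?Q = "Npow l \<oplus> Id ?p" and ?R = "Npow l \<oplus> Id (k + ?m)"
  have "f ;; g \<doteq> (?P ;; s) ;; (?Q ;; t)"
    using s t by (intro gqa_eq.cong_seq) auto
  also have "\<dots> \<doteq> ((?P ;; s) ;; ?Q) ;; t"
    by (intro gqa_eq.symm[OF gqa_eq.seq_assoc]) auto
  also have "\<dots> \<doteq> (?P ;; (s ;; ?Q)) ;; t"
    by (intro cong_seq_left gqa_eq.seq_assoc) auto
  \<comment> \<open>The Gaussians of \<open>g\<close> slide to the left across the affine part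
    \<open>s\<close> of \<open>f\<close>.\<close>
  also have "\<dots> \<doteq> (?P ;; (?R ;; (Id l \<oplus> s))) ;; t"
    using state_par_seq[of "Npow l" s] by (intro cong_seq_left cong_seq_right) auto
  also have "\<dots> \<doteq> ((?P ;; ?R) ;; (Id l \<oplus> s)) ;; t"
    by (intro cong_seq_left gqa_eq.symm[OF gqa_eq.seq_assoc]) auto
  also have "\<dots> \<doteq> ((Npow (l + k) \<oplus> Id ?m) ;; (Id l \<oplus> s)) ;; t"
    by (intro cong_seq_left Npow_par_Id_seq) auto
  also have "\<dots> \<doteq> (Npow (l + k) \<oplus> Id ?m) ;; ((Id l \<oplus> s) ;; t)"
    by (intro gqa_eq.seq_assoc) auto
  finally show ?case
    using s t by (intro exI[of _ "l + k"] bexI[of _ "(Id l \<oplus> s) ;; t"])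
      (auto simp: affine_diags_def diags_def)
next
  case (Par f g)
  let ?m = "src f" and ?p = "src g"
  have wf: "wf_diag f" "wf_diag g" using Par.prems by auto
  obtain k s where s: "s \<in> affine_diags (k + ?m) (tgt f)" "f \<doteq> (Npow k \<oplus> Id ?m) ;; s"
    using Par.IH(1) wf by auto
  obtain l t where t: "t \<in> affine_diags (l + ?p) (tgt g)" "g \<doteq> (Npow l \<oplus> Id ?p) ;; t"
    using Par.IH(2) wf by auto
  have ws: "wf_diag s" "src s = k + ?m" "tgt s = tgt f"
    and wt: "wf_diag t" "src t = l + ?p" "tgt t = tgt g"
    using s t by (auto simp: affine_diags_def diags_def)
  note [simp] = wf ws wt
  let ?P = "Npow k \<oplus> Id ?m" and ?Q = "Npow l \<oplus> Id ?p"
    and ?S = "Id k \<oplus> (Sym l ?m \<oplus> Id ?p)"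
  have "f \<oplus> g \<doteq> (?P ;; s) \<oplus> (?Q ;; t)"
    using s t by (intro gqa_eq.cong_par) auto
  also have "\<dots> \<doteq> (?P \<oplus> ?Q) ;; (s \<oplus> t)"
    by (intro gqa_eq.interchange) auto
  also have "\<dots> \<doteq> ((Npow (k + l) \<oplus> Id (?m + ?p)) ;; ?S) ;; (s \<oplus> t)"
    by (intro cong_seq_left Npow_par_shuffle) auto
  also have "\<dots> \<doteq> (Npow (k + l) \<oplus> Id (?m + ?p)) ;; (?S ;; (s \<oplus> t))"
    by (intro gqa_eq.seq_assoc) auto
  finally show ?case
    using s t by (intro exI[of _ "k + l"] bexI[of _ "?S ;; (s \<oplus> t)"])
      (auto simp: affine_diags_def diags_def)
qed

section \<open>Affine functions on lists\<close>

text \<open>Recursion on the dimension exposes the coefficient of the first coordinate, on which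
  elimination, realization and rotation all work. Only values on lists of length \<open>m\<close>
  are constrained.\<close>

primrec affine_fun :: "nat \<Rightarrow> (real list \<Rightarrow> real) \<Rightarrow> bool" where
  "affine_fun 0 f \<longleftrightarrow> True"
| "affine_fun (Suc m) f \<longleftrightarrow>
     (\<exists>a g. affine_fun m g \<and> (\<forall>x xs. length xs = m \<longrightarrow> f (x # xs) = a * x + g xs))"

definition affine_map :: "nat \<Rightarrow> nat \<Rightarrow> (real list \<Rightarrow> real list) \<Rightarrow> bool" where
  "affine_map m n F \<longleftrightarrow> (\<forall>x. length x = m \<longrightarrow> length (F x) = n) \<and>
     (\<forall>i<n. affine_fun m (\<lambda>x. F x ! i))"

lemma affine_fun_cong:
  "(\<And>x. length x = m \<Longrightarrow> f x = g x) \<Longrightarrow> affine_fun m f = affine_fun m g"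
  by (cases m) auto

lemma affine_fun_const [intro]: "affine_fun m (\<lambda>x. c)"
  by (induction m) (auto intro!: exI[of _ 0] exI[of _ "\<lambda>x. c"])

lemma affine_fun_add [intro]: "affine_fun m f \<Longrightarrow> affine_fun m g \<Longrightarrow> affine_fun m (\<lambda>x. f x + g x)"
proof (induction m arbitrary: f g)
  case (Suc m)
  obtain a f' where f: "affine_fun m f'" "\<And>x xs. length xs = m \<Longrightarrow> f (x # xs) = a * x + f' xs"
    using Suc.prems by auto
  obtain b g' where g: "affine_fun m g'" "\<And>x xs. length xs = m \<Longrightarrow> g (x # xs) = b * x + g' xs"
    using Suc.prems by auto
  show ?case
    using f g Suc.IH[OF f(1) g(1)]
    by (auto simp: algebra_simps intro!: exI[of _ "a + b"] exI[of _ "\<lambda>x. f' x + g' x"])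
qed auto

lemma affine_fun_scale [intro]: "affine_fun m f \<Longrightarrow> affine_fun m (\<lambda>x. c * f x)"
proof (induction m arbitrary: f)
  case (Suc m)
  obtain a f' where f: "affine_fun m f'" "\<And>x xs. length xs = m \<Longrightarrow> f (x # xs) = a * x + f' xs"
    using Suc.prems by auto
  show ?case
    using f Suc.IH[OF f(1)]
    by (auto simp: algebra_simps intro!: exI[of _ "c * a"] exI[of _ "\<lambda>x. c * f' x"])
qed auto

lemma affine_fun_diff [intro]:
  assumes "affine_fun m f" "affine_fun m g"
  shows "affine_fun m (\<lambda>x. f x - g x)"
  using affine_fun_add[OF assms(1) affine_fun_scale[OF assms(2), of "- 1"]] by simp

lemma affine_fun_nth [intro]: "i < m \<Longrightarrow> affine_fun m (\<lambda>x. x ! i)"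
proof (induction m arbitrary: i)
  case (Suc m)
  show ?case
  proof (cases i)
    case 0
    then show ?thesis by (auto intro!: exI[of _ 1] exI[of _ "\<lambda>x. 0"])
  next
    case (Suc j)
    then show ?thesis using Suc.prems Suc.IH[of j]
      by (auto intro!: exI[of _ 0] exI[of _ "\<lambda>x. x ! j"])
  qed
qed auto

section \<open>Affine maps: projection, pairing and composition\<close>

lemma affine_map_length: "affine_map m n F \<Longrightarrow> length x = m \<Longrightarrow> length (F x) = n"
  by (simp add: affine_map_def)

lemma affine_map_drop:
  assumes "affine_map m n F" "j \<le> n" "p = n - j"
  shows "affine_map m p (\<lambda>x. drop j (F x))"
  unfolding affine_map_def
proof (intro conjI allI impI)
  fix i assume i: "i < p"
  have "affine_fun m (\<lambda>x. F x ! (j + i))"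
    using assms i by (auto simp: affine_map_def)
  also have "affine_fun m (\<lambda>x. F x ! (j + i)) = affine_fun m (\<lambda>x. drop j (F x) ! i)"
    using assms i by (intro affine_fun_cong) (auto simp: affine_map_def)
  finally show "affine_fun m (\<lambda>x. drop j (F x) ! i)" .
qed (use assms in \<open>auto simp: affine_map_def\<close>)

lemma affine_map_take:
  assumes "affine_map m n F" "j \<le> n"
  shows "affine_map m j (\<lambda>x. take j (F x))"
  using assms unfolding affine_map_def by auto

lemma affine_map_append:
  assumes "affine_map m n F" "affine_map m p G" "q = n + p"
  shows "affine_map m q (\<lambda>x. F x @ G x)"
  unfolding affine_map_def
proof (intro conjI allI impI)
  fix i assume i: "i < q"
  have "affine_fun m (if i < n then (\<lambda>x. F x ! i) else (\<lambda>x. G x ! (i - n)))"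
    using assms i by (auto simp: affine_map_def)
  also have "affine_fun m (if i < n then (\<lambda>x. F x ! i) else (\<lambda>x. G x ! (i - n)))
      = affine_fun m (\<lambda>x. (F x @ G x) ! i)"
    using assms i by (intro affine_fun_cong) (auto simp: affine_map_def nth_append)
  finally show "affine_fun m (\<lambda>x. (F x @ G x) ! i)" .
qed (use assms in \<open>auto simp: affine_map_def\<close>)

lemma affine_map_id: "affine_map m m (\<lambda>x. x)"
  by (auto simp: affine_map_def)

lemma affine_map_Nil: "affine_map m 0 (\<lambda>x. [])"
  by (auto simp: affine_map_def)

lemma affine_map_Cons:
  "affine_fun m f \<Longrightarrow> affine_map m n F \<Longrightarrow> affine_map m (Suc n) (\<lambda>x. f x # F x)"
  unfolding affine_map_def by (auto simp: less_Suc_eq_0_disj)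

lemma affine_fun_comp:
  assumes "affine_fun n f" "affine_map m n F"
  shows "affine_fun m (\<lambda>x. f (F x))"
  using assms
proof (induction n arbitrary: f F)
  case 0
  then have "affine_fun m (\<lambda>x. f (F x)) = affine_fun m (\<lambda>x. f [])"
    by (intro affine_fun_cong) (auto simp: affine_map_def)
  then show ?case by auto
next
  case (Suc n)
  obtain a g where g: "affine_fun n g" "\<And>x xs. length xs = n \<Longrightarrow> f (x # xs) = a * x + g xs"
    using Suc.prems by auto
  have "affine_fun m (\<lambda>x. a * F x ! 0 + g (drop 1 (F x)))"
    using Suc.prems(2) affine_map_drop[OF Suc.prems(2), of 1 n]
    by (intro affine_fun_add affine_fun_scale Suc.IH[OF g(1)]) (auto simp: affine_map_def)
  also have "affine_fun m (\<lambda>x. a * F x ! 0 + g (drop 1 (F x))) = affine_fun m (\<lambda>x. f (F x))"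
  proof (rule affine_fun_cong)
    fix x :: "real list" assume "length x = m"
    then have "length (F x) = Suc n" using Suc.prems by (auto simp: affine_map_def)
    then show "a * F x ! 0 + g (drop 1 (F x)) = f (F x)"
      by (cases "F x") (auto simp: g)
  qed
  finally show ?case .
qed

lemma affine_map_comp:
  "affine_map n p G \<Longrightarrow> affine_map m n F \<Longrightarrow> affine_map m p (\<lambda>x. G (F x))"
  unfolding affine_map_def[of m p] affine_map_def[of n p]
  by (auto simp: affine_map_length intro: affine_fun_comp)

text \<open>The hidden variables are scanned from the left for a nonzero coefficient. The first one
  found is solved for, and \<open>\<sigma>\<close> parametrizes the solutions by the others; if
  there is none, the equation speaks of \<open>x\<close> alone.\<close>

lemma affine_equation_cases:
  assumes "affine_fun (e + k) f"
  shows "(\<exists>e' \<sigma>. e = Suc e' \<and> affine_map (e' + k) e \<sigma> \<and>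
       (\<forall>x. length x = k \<longrightarrow>
         {y. length y = e \<and> f (y @ x) = 0} = (\<lambda>y'. \<sigma> (y' @ x)) ` {y'. length y' = e'})) \<or>
     (\<exists>g. affine_fun k g \<and> (\<forall>x y. length x = k \<longrightarrow> length y = e \<longrightarrow> f (y @ x) = g x))"
  using assms
proof (induction e arbitrary: f)
  case 0
  then show ?case by auto
next
  case (Suc e)
  obtain a h where h: "affine_fun (e + k) h"
      "\<And>x xs. length xs = e + k \<Longrightarrow> f (x # xs) = a * x + h xs"
    using Suc.prems by auto
  show ?case
  proof (cases "a = 0")
    case False
    \<comment> \<open>The head variable is solved for; the \<open>e\<close> remaining hidden
      variables are the parameters, and \<open>take e\<close> strips off the inputs.\<close>
    let ?\<sigma> = "\<lambda>v. (- (1 / a)) * h v # take e v"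
    have "affine_map (e + k) (Suc e) ?\<sigma>"
      by (intro affine_map_Cons affine_map_take[of _ "e + k"] affine_map_id affine_fun_scale h) auto
    moreover have "{y. length y = Suc e \<and> f (y @ x) = 0}
        = (\<lambda>y'. ?\<sigma> (y' @ x)) ` {y'. length y' = e}" if "length x = k" for x
      using that False by (auto simp: length_Suc_conv h field_simps image_iff)
    ultimately show ?thesis by blast
  next
    case True
    from Suc.IH[OF h(1)] show ?thesis
    proof (elim disjE exE conjE)
      fix g assume g: "affine_fun k g"
        "\<forall>x y. length x = k \<longrightarrow> length y = e \<longrightarrow> h (y @ x) = g x"
      then have "\<forall>x y. length x = k \<longrightarrow> length y = Suc e \<longrightarrow> f (y @ x) = g x"
        using True by (auto simp: h length_Suc_conv)
      with g(1) show ?thesis by blast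
    next
      fix e' \<sigma> assume e: "e = Suc e'" and \<sigma>: "affine_map (e' + k) e \<sigma>" and *: "\<forall>x. length x = k \<longrightarrow>
         {y. length y = e \<and> h (y @ x) = 0} = (\<lambda>y'. \<sigma> (y' @ x)) ` {y'. length y' = e'}"
      \<comment> \<open>The head has coefficient 0, so it stays free and is carried along in front
        of the other parameters.\<close>
      let ?\<tau> = "\<lambda>v. v ! 0 # \<sigma> (drop 1 v)"
      have "affine_map (Suc e' + k) (Suc e) ?\<tau>"
        by (intro affine_map_Cons affine_fun_nth affine_map_comp[OF \<sigma>] affine_map_drop[of _ "Suc e' + k"]
            affine_map_id) auto
      moreover have "{y. length y = Suc e \<and> f (y @ x) = 0}
          = (\<lambda>y'. ?\<tau> (y' @ x)) ` {y'. length y' = Suc e'}" if x: "length x = k" for x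
      proof -
        have "{y. length y = Suc e \<and> f (y @ x) = 0}
            = {a # y | a y. y \<in> {y. length y = e \<and> h (y @ x) = 0}}"
          using True x by (auto simp: length_Suc_conv h)
        also have "\<dots> = (\<lambda>y'. ?\<tau> (y' @ x)) ` {y'. length y' = Suc e'}"
          unfolding *[rule_format, OF x] by (force simp: length_Suc_conv image_iff)
        finally show ?thesis .
      qed
      ultimately show ?thesis using e by blast
    qed
  qed
qed


section \<open>Implicit presentations of affine relations\<close>

text \<open>The hidden variables precede the inputs, where \<open>affine_equation_cases\<close>
  looks for one to eliminate. The equations form a list because the later induction runs on their
  number.\<close>

definition presents ::
  "gen diag \<Rightarrow> nat \<Rightarrow> nat \<Rightarrow> nat \<Rightarrow> (real list \<Rightarrow> real list) \<Rightarrow> (real list \<Rightarrow> real) list \<Rightarrow> bool" where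
  "presents s m n e F fs \<longleftrightarrow>
     affine_map (e + m) n F \<and> (\<forall>f\<in>set fs. affine_fun (e + m) f) \<and>
     (\<forall>x z. length x = m \<longrightarrow> length z = n \<longrightarrow>
       (rel s x z \<longleftrightarrow> (\<exists>y. length y = e \<and> z = F (y @ x) \<and> (\<forall>f\<in>set fs. f (y @ x) = 0))))"

lemma presentsI:
  assumes "affine_map (e + m) n F" "\<And>f. f \<in> set fs \<Longrightarrow> affine_fun (e + m) f"
    and "\<And>x z. length x = m \<Longrightarrow> length z = n \<Longrightarrow>
       rel s x z \<longleftrightarrow> (\<exists>y. length y = e \<and> z = F (y @ x) \<and> (\<forall>f\<in>set fs. f (y @ x) = 0))"
  shows "presents s m n e F fs"
  using assms by (simp add: presents_def)

lemma length_1_conv: "length x = Suc 0 \<longleftrightarrow> (\<exists>a. x = [a])"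
  by (auto simp: length_Suc_conv)

lemma length_2_conv: "length x = Suc (Suc 0) \<longleftrightarrow> (\<exists>a b. x = [a, b])"
  by (auto simp: length_Suc_conv)

text \<open>Most generators are graphs of affine maps; \<open>BUnit\<close> and
  \<open>WComult\<close> need a hidden variable, \<open>BMult\<close> and \<open>WCounit\<close> an
  equation. Both compositions merely merge these data.\<close>

lemma affine_presentation:
  "wf_diag d \<Longrightarrow> NGen \<notin> gens d \<Longrightarrow> \<exists>e F fs. presents d (src d) (tgt d) e F fs"
proof (induction d)
  case (Gen g)
  note conv = length_1_conv length_2_conv numeral_2_eq_2
  note aff = affine_map_Cons affine_map_Nil affine_fun_add affine_fun_diff affine_fun_scale
    affine_fun_const affine_fun_nth
  show ?case
  proof (cases g)
    case Copy
    then have "presents (Gen g) 1 2 0 (\<lambda>x. [x ! 0, x ! 0]) []"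
      unfolding numeral_2_eq_2 by (intro presentsI aff) (auto simp: conv)
    with Copy show ?thesis by auto
  next
    case Discard
    then have "presents (Gen g) 1 0 0 (\<lambda>x. []) []"
      by (intro presentsI aff) (auto simp: conv)
    with Discard show ?thesis by auto
  next
    case BMult
    then have "presents (Gen g) 2 1 0 (\<lambda>x. [x ! 0]) [\<lambda>x. x ! 0 - x ! 1]"
      unfolding One_nat_def by (intro presentsI aff) (auto simp: conv simp del: affine_fun.simps)
    with BMult show ?thesis by auto
  next
    case BUnit
    then have "presents (Gen g) 0 1 1 (\<lambda>x. [x ! 0]) []"
      unfolding One_nat_def by (intro presentsI aff) (auto simp: conv)
    with BUnit show ?thesis by auto
  next
    case Add
    then have "presents (Gen g) 2 1 0 (\<lambda>x. [x ! 0 + x ! 1]) []"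
      unfolding One_nat_def by (intro presentsI aff) (auto simp: conv)
    with Add show ?thesis by auto
  next
    case Zero
    then have "presents (Gen g) 0 1 0 (\<lambda>x. [0]) []"
      unfolding One_nat_def by (intro presentsI aff) (auto simp: conv)
    with Zero show ?thesis by auto
  next
    case WComult
    \<comment> \<open>Index 0 is the hidden variable, chosen as the first summand; index 1 is the
      input.\<close>
    then have "presents (Gen g) 1 2 1 (\<lambda>x. [x ! 0, x ! 1 - x ! 0]) []"
      unfolding numeral_2_eq_2 by (intro presentsI aff) (auto simp: conv)
    with WComult show ?thesis by auto
  next
    case WCounit
    then have "presents (Gen g) 1 0 0 (\<lambda>x. []) [\<lambda>x. x ! 0]"
      by (intro presentsI aff) (auto simp: conv intro!: exI[of _ 1])
    with WCounit show ?thesis by auto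
  next
    case (Scalar c)
    then have "presents (Gen g) 1 1 0 (\<lambda>x. [c * x ! 0]) []"
      unfolding One_nat_def by (intro presentsI aff) (auto simp: conv)
    with Scalar show ?thesis by auto
  next
    case One
    then have "presents (Gen g) 0 1 0 (\<lambda>x. [1]) []"
      unfolding One_nat_def by (intro presentsI aff) (auto simp: conv)
    with One show ?thesis by auto
  next
    case NGen
    with Gen show ?thesis by simp
  qed
next
  case (Id n)
  have "presents (Id n) n n 0 (\<lambda>x. x) []"
    by (intro presentsI) (auto simp: affine_map_id)
  then show ?case by auto
next
  case (Sym m n)
  have "presents (Sym m n) (m + n) (n + m) 0 (\<lambda>x. drop m x @ take m x) []"
    by (intro presentsI affine_map_append[of _ n _ m] affine_map_drop[OF affine_map_id]
        affine_map_take[OF affine_map_id]) auto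
  then show ?case by auto
next
  case (Seq s t)
  then obtain e1 F1 fs1 e2 F2 fs2 where
    1: "presents s (src s) (tgt s) e1 F1 fs1" and 2: "presents t (tgt s) (tgt t) e2 F2 fs2"
    by auto
  \<comment> \<open>A vector \<open>v\<close> is laid out as \<open>y2 @ y1 @ x\<close>; the value
    of \<open>F1\<close> at \<open>y1 @ x\<close> is the intermediate point where \<open>t\<close>
    takes over.\<close>
  let ?mid = "\<lambda>v. take e2 v @ F1 (drop e2 v)"
  let ?fs = "map (\<lambda>f v. f (drop e2 v)) fs1 @ map (\<lambda>f v. f (?mid v)) fs2"
  have drop: "affine_map (e2 + e1 + src s) (e1 + src s) (drop e2)"
    by (rule affine_map_drop[OF affine_map_id]) auto
  have mid: "affine_map (e2 + e1 + src s) (e2 + tgt s) ?mid"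
  proof (rule affine_map_append)
    show "affine_map (e2 + e1 + src s) e2 (take e2)"
      by (rule affine_map_take[OF affine_map_id]) auto
    show "affine_map (e2 + e1 + src s) (tgt s) (\<lambda>v. F1 (drop e2 v))"
      using 1 by (intro affine_map_comp[OF _ drop]) (auto simp: presents_def)
  qed auto
  have "presents (s ;; t) (src s) (tgt t) (e2 + e1) (\<lambda>v. F2 (?mid v)) ?fs"
  proof (rule presentsI)
    show "affine_map (e2 + e1 + src s) (tgt t) (\<lambda>v. F2 (?mid v))"
      using 2 by (intro affine_map_comp[OF _ mid]) (auto simp: presents_def)
    show "affine_fun (e2 + e1 + src s) f" if "f \<in> set ?fs" for f
      using that 1 2 affine_fun_comp[OF _ drop] affine_fun_comp[OF _ mid]
      by (auto simp: presents_def)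
    fix x z :: "real list" assume x: "length x = src s" and z: "length z = tgt t"
    have "rel (s ;; t) x z \<longleftrightarrow> (\<exists>y1 y2. length y1 = e1 \<and> length y2 = e2 \<and>
        (\<forall>f\<in>set fs1. f (y1 @ x) = 0) \<and> z = F2 (y2 @ F1 (y1 @ x)) \<and>
        (\<forall>f\<in>set fs2. f (y2 @ F1 (y1 @ x)) = 0))" (is "_ \<longleftrightarrow> ?R")
    proof -
      have "rel (s ;; t) x z \<longleftrightarrow> (\<exists>w. length w = tgt s \<and>
          (\<exists>y1. length y1 = e1 \<and> w = F1 (y1 @ x) \<and> (\<forall>f\<in>set fs1. f (y1 @ x) = 0)) \<and>
          (\<exists>y2. length y2 = e2 \<and> z = F2 (y2 @ w) \<and> (\<forall>f\<in>set fs2. f (y2 @ w) = 0)))"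
        using 1 2 x z unfolding presents_def rel.simps by metis
      moreover have "length (F1 (y1 @ x)) = tgt s" if "length y1 = e1" for y1
        using 1 x that by (auto simp: presents_def affine_map_def)
      ultimately show ?thesis by blast
    qed
    also have "\<dots> \<longleftrightarrow> (\<exists>y. length y = e2 + e1 \<and> z = F2 (?mid (y @ x)) \<and>
        (\<forall>f\<in>set ?fs. f (y @ x) = 0))" (is "_ \<longleftrightarrow> ?S")
    proof
      assume ?R
      then obtain y1 y2 where "length y1 = e1 \<and> length y2 = e2 \<and>
        (\<forall>f\<in>set fs1. f (y1 @ x) = 0) \<and> z = F2 (y2 @ F1 (y1 @ x)) \<and>
        (\<forall>f\<in>set fs2. f (y2 @ F1 (y1 @ x)) = 0)" by blast
      then show ?S by (intro exI[of _ "y2 @ y1"]) (auto simp: ball_Un)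
    next
      assume ?S
      then obtain y where "length y = e2 + e1 \<and> z = F2 (?mid (y @ x)) \<and>
        (\<forall>f\<in>set ?fs. f (y @ x) = 0)" by blast
      then show ?R
        by (intro exI[of "\<lambda>y1. \<exists>y2. _ y1 y2" "drop e2 y"] exI[of _ "take e2 y"])
          (auto simp: ball_Un)
    qed
    finally show "rel (s ;; t) x z \<longleftrightarrow> ?S" .
  qed
  then show ?case by auto
next
  case (Par s t)
  then obtain e1 F1 fs1 e2 F2 fs2 where
    1: "presents s (src s) (tgt s) e1 F1 fs1" and 2: "presents t (src t) (tgt t) e2 F2 fs2"
    by auto
  let ?m = "e1 + e2 + (src s + src t)"
  \<comment> \<open>Here the layout is \<open>y1 @ y2 @ x1 @ x2\<close>; the two selections extract
    \<open>y1 @ x1\<close> and \<open>y2 @ x2\<close>.\<close>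
  let ?p1 = "\<lambda>v. take e1 v @ take (src s) (drop (e1 + e2) v)"
  let ?p2 = "\<lambda>v. take e2 (drop e1 v) @ drop (e1 + e2 + src s) v"
  let ?fs = "map (\<lambda>f v. f (?p1 v)) fs1 @ map (\<lambda>f v. f (?p2 v)) fs2"
  have p1: "affine_map ?m (e1 + src s) ?p1"
  proof (rule affine_map_append)
    show "affine_map ?m e1 (take e1)"
      by (rule affine_map_take[OF affine_map_id]) auto
    show "affine_map ?m (src s) (\<lambda>v. take (src s) (drop (e1 + e2) v))"
      by (rule affine_map_take[OF affine_map_drop[OF affine_map_id]]) auto
  qed auto
  have p2: "affine_map ?m (e2 + src t) ?p2"
  proof (rule affine_map_append)
    show "affine_map ?m e2 (\<lambda>v. take e2 (drop e1 v))"
      by (rule affine_map_take[OF affine_map_drop[OF affine_map_id]]) auto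
    show "affine_map ?m (src t) (drop (e1 + e2 + src s))"
      by (rule affine_map_drop[OF affine_map_id]) auto
  qed auto
  have "presents (s \<oplus> t) (src s + src t) (tgt s + tgt t) (e1 + e2)
      (\<lambda>v. F1 (?p1 v) @ F2 (?p2 v)) ?fs"
  proof (rule presentsI)
    show "affine_map ?m (tgt s + tgt t) (\<lambda>v. F1 (?p1 v) @ F2 (?p2 v))"
      using 1 2 by (intro affine_map_append[OF affine_map_comp[OF _ p1] affine_map_comp[OF _ p2]])
        (auto simp: presents_def)
    show "affine_fun ?m f" if "f \<in> set ?fs" for f
      using that 1 2 affine_fun_comp[OF _ p1] affine_fun_comp[OF _ p2]
      by (auto simp: presents_def)
    fix x z :: "real list" assume x: "length x = src s + src t" and z: "length z = tgt s + tgt t"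
    define x1 x2 where x12: "x1 = take (src s) x" "x2 = drop (src s) x"
    have l: "length x1 = src s" "length x2 = src t" and xx: "x = x1 @ x2"
      using x by (auto simp: x12)
    have *: "z = F1 (y1 @ x1) @ F2 (y2 @ x2) \<longleftrightarrow>
        take (tgt s) z = F1 (y1 @ x1) \<and> drop (tgt s) z = F2 (y2 @ x2)"
      if "length y1 = e1" "length y2 = e2" for y1 y2
    proof -
      have "length (F1 (y1 @ x1)) = tgt s"
        using 1 l that by (auto simp: presents_def affine_map_def)
      then show ?thesis using append_eq_conv_conj[of "F1 (y1 @ x1)" "F2 (y2 @ x2)" z] by auto
    qed
    have "rel (s \<oplus> t) x z \<longleftrightarrow>
       (\<exists>y1. length y1 = e1 \<and> take (tgt s) z = F1 (y1 @ x1) \<and> (\<forall>f\<in>set fs1. f (y1 @ x1) = 0)) \<and>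
       (\<exists>y2. length y2 = e2 \<and> drop (tgt s) z = F2 (y2 @ x2) \<and> (\<forall>f\<in>set fs2. f (y2 @ x2) = 0))"
      using 1 2 l z by (simp add: presents_def x12)
    also have "\<dots> \<longleftrightarrow> (\<exists>y1 y2. length y1 = e1 \<and> length y2 = e2 \<and>
       z = F1 (y1 @ x1) @ F2 (y2 @ x2) \<and>
       (\<forall>f\<in>set fs1. f (y1 @ x1) = 0) \<and> (\<forall>f\<in>set fs2. f (y2 @ x2) = 0))" (is "_ \<longleftrightarrow> ?R")
      using * by blast
    also have "\<dots> \<longleftrightarrow> (\<exists>y. length y = e1 + e2 \<and> z = F1 (?p1 (y @ x)) @ F2 (?p2 (y @ x)) \<and>
        (\<forall>f\<in>set ?fs. f (y @ x) = 0))" (is "_ \<longleftrightarrow> ?S")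
    proof
      assume ?R
      then obtain y1 y2 where "length y1 = e1 \<and> length y2 = e2 \<and>
        z = F1 (y1 @ x1) @ F2 (y2 @ x2) \<and>
        (\<forall>f\<in>set fs1. f (y1 @ x1) = 0) \<and> (\<forall>f\<in>set fs2. f (y2 @ x2) = 0)" by blast
      then show ?S using l by (intro exI[of _ "y1 @ y2"]) (auto simp: xx)
    next
      assume ?S
      then obtain y where "length y = e1 + e2 \<and> z = F1 (?p1 (y @ x)) @ F2 (?p2 (y @ x)) \<and>
        (\<forall>f\<in>set ?fs. f (y @ x) = 0)" by blast
      then show ?R using l
        by (intro exI[of "\<lambda>y1. \<exists>y2. _ y1 y2" "take e1 y"] exI[of _ "drop e1 y"])
          (auto simp: xx ball_Un)
    qed
    finally show "rel (s \<oplus> t) x z \<longleftrightarrow> ?S" .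
  qed
  then show ?case by auto
qed

section \<open>Diagrams realizing affine maps\<close>

text \<open>The bound on the generators makes these diagrams admissible in \<open>M'\<close>, while
  freedom from \<open>NGen\<close> keeps them open to axiom \<open>E\<close>.\<close>

definition realizes :: "gen diag \<Rightarrow> nat \<Rightarrow> nat \<Rightarrow> (real list \<Rightarrow> real list) \<Rightarrow> bool" where
  "realizes t m n F \<longleftrightarrow> t \<in> affine_diags m n \<and> gens t \<subseteq> GQA_E_gens \<and>
     (\<forall>x. length x = m \<longrightarrow> length (F x) = n \<and>
       (\<forall>z. length z = n \<longrightarrow> (rel t x z \<longleftrightarrow> z = F x)))"

lemma realizes_typed:
  "realizes t m n F \<Longrightarrow> wf_diag t \<and> src t = m \<and> tgt t = n \<and> NGen \<notin> gens t \<and> gens t \<subseteq> GQA_E_gens"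
  by (auto simp: realizes_def affine_diags_def diags_def)

lemma realizes_cong:
  "realizes t m n F \<Longrightarrow> (\<And>x. length x = m \<Longrightarrow> F x = G x) \<Longrightarrow> realizes t m n G"
  by (simp add: realizes_def)

lemma rel_realizes_seq:
  "realizes Q j k q \<Longrightarrow> length x = j \<Longrightarrow> rel (Q ;; s) x z \<longleftrightarrow> rel s (q x) z"
  by (auto simp: realizes_def affine_diags_def diags_def)

lemma realizes_Id: "realizes (Id m) m m (\<lambda>x. x)"
  by (auto simp: realizes_def affine_diags_def diags_def)

lemma realizes_Sym: "realizes (Sym m n) (m + n) (n + m) (\<lambda>x. drop m x @ take m x)"
  by (auto simp: realizes_def affine_diags_def diags_def)

lemma realizes_seq:
  assumes "realizes s m n F" "realizes t n p G"
  shows "realizes (s ;; t) m p (\<lambda>x. G (F x))"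
  using assms by (fastforce simp: realizes_def affine_diags_def diags_def)

lemma realizes_par:
  assumes "realizes s m n F" "realizes t p q G"
  shows "realizes (s \<oplus> t) (m + p) (n + q) (\<lambda>x. F (take m x) @ G (drop m x))"
  unfolding realizes_def
proof (intro conjI allI impI)
  fix x z :: "real list" assume x: "length x = m + p" and z: "length z = n + q"
  have "length (F (take m x)) = n" using assms x by (simp add: realizes_def)
  then have "z = F (take m x) @ G (drop m x) \<longleftrightarrow>
      take n z = F (take m x) \<and> drop n z = G (drop m x)"
    using append_eq_conv_conj[of "F (take m x)" "G (drop m x)" z] by auto
  with assms x z show "rel (s \<oplus> t) x z \<longleftrightarrow> z = F (take m x) @ G (drop m x)"
    by (simp add: realizes_def affine_diags_def diags_def)
qed (use assms in \<open>auto simp: realizes_def affine_diags_def diags_def\<close>)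

lemma realizes_gens:
  "realizes (Gen Copy) 1 2 (\<lambda>x. [x ! 0, x ! 0])"
  "realizes (Gen Discard) 1 0 (\<lambda>x. [])"
  "realizes (Gen Add) 2 1 (\<lambda>x. [x ! 0 + x ! 1])"
  "realizes (Gen (Scalar c)) 1 1 (\<lambda>x. [c * x ! 0])"
  "realizes (Gen One) 0 1 (\<lambda>x. [1])"
  by (auto simp: realizes_def affine_diags_def diags_def GQA_E_gens_def numeral_2_eq_2
      length_1_conv length_2_conv)

lemma realizes_const: "realizes (Gen One ;; Gen (Scalar c)) 0 1 (\<lambda>x. [c])"
  using realizes_seq[OF realizes_gens(5) realizes_gens(4)[of c]] by simp

lemma ex_realizes_copy: "\<exists>t. realizes t m (m + m) (\<lambda>x. x @ x)"
proof (induction m)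
  case 0
  have "realizes (Id 0) 0 0 (\<lambda>x. x @ x)" by (rule realizes_cong[OF realizes_Id]) auto
  then show ?case by auto
next
  case (Suc m)
  then obtain t where t: "realizes t m (m + m) (\<lambda>x. x @ x)" by blast
  have a: "realizes (Gen Copy \<oplus> t) (1 + m) (2 + (m + m))
      (\<lambda>x. [take 1 x ! 0, take 1 x ! 0] @ drop 1 x @ drop 1 x)"
    by (rule realizes_par[OF realizes_gens(1) t])
  \<comment> \<open>After copying, the wires read head, head, tail, tail; \<open>Sym 1 m\<close>
    exchanges the second head with the first tail.\<close>
  have b: "realizes (Id 1 \<oplus> (Sym 1 m \<oplus> Id m)) (2 + (m + m)) (Suc m + Suc m)
      (\<lambda>x. take 1 x @ (drop 1 (take (1 + m) (drop 1 x)) @ take 1 (take (1 + m) (drop 1 x)))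
         @ drop (1 + m) (drop 1 x))"
    using realizes_par[OF realizes_Id[of 1] realizes_par[OF realizes_Sym[of 1 m] realizes_Id[of m]]]
    by simp
  have "realizes ((Gen Copy \<oplus> t) ;; (Id 1 \<oplus> (Sym 1 m \<oplus> Id m))) (1 + m) (Suc m + Suc m)
      (\<lambda>x. x @ x)"
    by (rule realizes_cong[OF realizes_seq[OF a b]]) (auto simp: length_Suc_conv)
  then show ?case by auto
qed

lemma ex_realizes_discard: "\<exists>t. realizes t m 0 (\<lambda>x. [])"
proof (induction m)
  case 0
  then show ?case by (intro exI[of _ "Id 0"] realizes_cong[OF realizes_Id]) auto
next
  case (Suc m)
  then obtain t where "realizes t m 0 (\<lambda>x. [])" by blast
  from realizes_par[OF realizes_gens(2) this] show ?case by auto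
qed

lemma ex_realizes_affine_fun: "affine_fun m f \<Longrightarrow> \<exists>t. realizes t m 1 (\<lambda>x. [f x])"
proof (induction m arbitrary: f)
  case 0
  then show ?case
    by (intro exI[of _ "Gen One ;; Gen (Scalar (f []))"] realizes_cong[OF realizes_const]) auto
next
  case (Suc m)
  obtain a g where g: "affine_fun m g" "\<And>x xs. length xs = m \<Longrightarrow> f (x # xs) = a * x + g xs"
    using Suc.prems by auto
  obtain t where t: "realizes t m 1 (\<lambda>x. [g x])" using Suc.IH g by blast
  have "realizes ((Gen (Scalar a) \<oplus> t) ;; Gen Add) (1 + m) 1
      (\<lambda>x. [([a * take 1 x ! 0] @ [g (drop 1 x)]) ! 0 + ([a * take 1 x ! 0] @ [g (drop 1 x)]) ! 1])"
    using realizes_par[OF realizes_gens(4) t, of a]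
    by (intro realizes_seq[OF _ realizes_gens(3)]) (simp add: numeral_2_eq_2)
  then have "realizes ((Gen (Scalar a) \<oplus> t) ;; Gen Add) (1 + m) 1 (\<lambda>x. [f x])"
    by (rule realizes_cong) (auto simp: length_Suc_conv g)
  then show ?case by auto
qed

text \<open>The input is duplicated: one copy feeds the first output, the other the remaining
  outputs by induction.\<close>

lemma ex_realizes_affine_map: "affine_map m n F \<Longrightarrow> \<exists>t. realizes t m n F"
proof (induction n arbitrary: F)
  case 0
  obtain t where "realizes t m 0 (\<lambda>x. [])" using ex_realizes_discard by blast
  then have "realizes t m 0 F" by (rule realizes_cong) (use 0 in \<open>auto simp: affine_map_def\<close>)
  then show ?case by blast
next
  case (Suc n)
  obtain c where c: "realizes c m (m + m) (\<lambda>x. x @ x)" using ex_realizes_copy by blast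
  obtain s where s: "realizes s m 1 (\<lambda>x. [F x ! 0])"
    using ex_realizes_affine_fun[of m "\<lambda>x. F x ! 0"] Suc.prems by (auto simp: affine_map_def)
  obtain t where t: "realizes t m n (\<lambda>x. drop 1 (F x))"
    using Suc.IH[OF affine_map_drop[OF Suc.prems, of 1]] by auto
  have "realizes (c ;; (s \<oplus> t)) m (1 + n) F"
  proof (rule realizes_cong[OF realizes_seq[OF c realizes_par[OF s t]]])
    fix x :: "real list" assume x: "length x = m"
    then have "length (F x) = Suc n" using Suc.prems by (simp add: affine_map_def)
    with x show "[F (take m (x @ x)) ! 0] @ drop 1 (F (drop m (x @ x))) = F x"
      by (cases "F x") auto
  qed
  then show ?case by auto
qed

lemma rot_realizes:
  "realizes (rot \<phi>) 2 2 (\<lambda>x. [cos \<phi> * x ! 0 - sin \<phi> * x ! 1, sin \<phi> * x ! 0 + cos \<phi> * x ! 1])"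
proof -
  have N: "NGen \<notin> gens (rot \<phi>)" by (simp add: rot_def)
  have "rel (rot \<phi>) [x1, x2] [y1, y2] \<longleftrightarrow>
      y1 = cos \<phi> * x1 - sin \<phi> * x2 \<and> y2 = sin \<phi> * x1 + cos \<phi> * x2" for x1 x2 y1 y2
    using rot_interp[of \<phi> x1 x2 y1 y2] interp_eq_constr_rel[OF N, of "[x1, x2]" "[y1, y2]"]
    by (simp add: constr_def split: if_splits)
  moreover have "gens (rot \<phi>) \<subseteq> GQA_E_gens" by (simp add: rot_def GQA_E_gens_def)
  ultimately show ?thesis
    using N rot_typed[of \<phi>]
    by (auto simp: realizes_def affine_diags_def numeral_2_eq_2 length_2_conv)
qed

text \<open>Unconstrained outputs: they supply the hidden variables once no equation is left, and
  the arbitrary output beside a contradiction.\<close>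

primrec BUnits :: "nat \<Rightarrow> gen diag" where
  "BUnits 0 = Id 0"
| "BUnits (Suc k) = Gen BUnit \<oplus> BUnits k"

lemma BUnits_typed [simp]:
  "wf_diag (BUnits k)" "src (BUnits k) = 0" "tgt (BUnits k) = k"
  "NGen \<notin> gens (BUnits k)" "gens (BUnits k) \<subseteq> GQA_E_gens"
  by (induction k) (auto simp: GQA_E_gens_def)

lemma rel_BUnits [simp]: "length y = k \<Longrightarrow> rel (BUnits k) [] y"
  by (induction k arbitrary: y) auto


section \<open>Rotating a functional\<close>

lemma Npow_Suc_seq_par:
  assumes "wf_diag f" "wf_diag g" "src f = 1" "src g = k"
  shows "Npow (Suc k) ;; (f \<oplus> g) \<doteq> (Gen NGen ;; f) \<oplus> (Npow k ;; g)"
  using assms by (auto intro!: gqa_eq.symm[OF gqa_eq.interchange])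

lemma Npow_rot:
  assumes "0 \<le> \<phi>" "\<phi> < 2 * pi"
  shows "Npow (Suc (Suc k)) ;; (rot \<phi> \<oplus> Id k) \<doteq> Npow (Suc (Suc k))"
proof -
  note [simp] = realizes_typed[OF rot_realizes]
  let ?N = "Gen NGen"
  have "Npow (Suc (Suc k)) ;; (rot \<phi> \<oplus> Id k) \<doteq> ((?N \<oplus> ?N) \<oplus> Npow k) ;; (rot \<phi> \<oplus> Id k)"
    by (simp del: One_nat_def) (intro cong_seq_left gqa_eq.symm[OF gqa_eq.par_assoc]; simp)
  also have "\<dots> \<doteq> ((?N \<oplus> ?N) ;; rot \<phi>) \<oplus> (Npow k ;; Id k)"
    by (intro gqa_eq.symm[OF gqa_eq.interchange]) auto
  also have "\<dots> \<doteq> (?N \<oplus> ?N) \<oplus> Npow k"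
    using gqa_eq.RI[OF assms] gqa_eq.seq_id_right[of "Npow k"] by (intro gqa_eq.cong_par) auto
  also have "\<dots> \<doteq> Npow (Suc (Suc k))"
    using gqa_eq.par_assoc[of ?N ?N "Npow k"] by simp
  finally show ?thesis .
qed

text \<open>Polar coordinates, with the angle in the range that \<open>RI\<close> admits.\<close>

lemma ex_angle: "\<exists>\<phi> r. 0 \<le> \<phi> \<and> \<phi> < 2 * pi \<and> 0 \<le> r \<and> a = r * cos \<phi> \<and> b = r * sin \<phi>"
proof (cases "a = 0 \<and> b = 0")
  case True
  then show ?thesis by (intro exI[of _ 0]) auto
next
  case False
  define r where "r = sqrt (a\<^sup>2 + b\<^sup>2)"
  have r: "r > 0" "r\<^sup>2 = a\<^sup>2 + b\<^sup>2"
    using False by (auto simp: r_def sum_power2_gt_zero_iff)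
  then have "(a / r)\<^sup>2 + (b / r)\<^sup>2 = 1"
    using False by (simp add: power_divide flip: add_divide_distrib)
  from sincos_total_2pi[OF this] obtain \<phi> where "0 \<le> \<phi>" "\<phi> < 2 * pi" "a / r = cos \<phi>" "b / r = sin \<phi>"
    by blast
  with r show ?thesis by (intro exI[of _ \<phi>] exI[of _ r]) (auto simp: field_simps)
qed

text \<open>Givens rotations: the tail is first rotated so that only its first coordinate matters,
  then a plane rotation merges that coefficient with the one of the head. The Gaussians absorb each
  rotation by \<open>RI\<close>. The case \<open>[]\<close> covers dimension 0, where
  \<open>g\<close> is constant.\<close>

lemma rotate_functional:
  "affine_fun k g \<Longrightarrow> \<exists>Q q r \<gamma>. realizes Q k k q \<and> affine_map k k q \<and> Npow k ;; Q \<doteq> Npow k \<and>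
     (\<forall>x. length x = k \<longrightarrow> g (q x) = (case x of [] \<Rightarrow> \<gamma> | a # _ \<Rightarrow> r * a + \<gamma>))"
proof (induction k arbitrary: g)
  case 0
  show ?case
    by (intro exI[of _ "Id 0"] exI[of _ "\<lambda>x. x"] exI[of _ 0] exI[of _ "g []"])
      (use gqa_eq.seq_id_left[of "Id 0"] in \<open>simp add: realizes_Id affine_map_id\<close>)
next
  case (Suc k)
  obtain a h where h: "affine_fun k h" "\<And>x xs. length xs = k \<Longrightarrow> g (x # xs) = a * x + h xs"
    using Suc.prems by auto
  obtain Q q r \<gamma> where Q: "realizes Q k k q" "affine_map k k q" "Npow k ;; Q \<doteq> Npow k"
    and hq: "\<And>x. length x = k \<Longrightarrow> h (q x) = (case x of [] \<Rightarrow> \<gamma> | a # _ \<Rightarrow> r * a + \<gamma>)"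
    using Suc.IH[OF h(1)] by blast
  show ?case
  proof (cases k)
    case 0
    have "Npow 1 ;; Id 1 \<doteq> Npow 1" using gqa_eq.seq_id_right[of "Npow 1"] by simp
    with 0 h show ?thesis
      by (intro exI[of _ "Id 1"] exI[of _ "\<lambda>x. x"] exI[of _ a] exI[of _ "h []"])
        (auto simp: realizes_Id[of "Suc 0"] affine_map_id length_1_conv)
  next
    case (Suc j)
    \<comment> \<open>The coefficients \<open>a\<close> of the head and \<open>r\<close> of the
      rotated tail in polar form; turning by \<open>\<phi>\<close> leaves \<open>s\<close> on the
      first coordinate and 0 on the second.\<close>
    obtain \<phi> s where \<phi>: "0 \<le> \<phi>" "\<phi> < 2 * pi" and as: "a = s * cos \<phi>" and rs: "r = s * sin \<phi>"
      using ex_angle[of a r] by blast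
    let ?R = "\<lambda>x. [cos \<phi> * x ! 0 - sin \<phi> * x ! 1, sin \<phi> * x ! 0 + cos \<phi> * x ! 1]"
    let ?q = "\<lambda>x. (cos \<phi> * x ! 0 - sin \<phi> * x ! 1) #
      q ((sin \<phi> * x ! 0 + cos \<phi> * x ! 1) # drop 2 x)"
    \<comment> \<open>Functionals are pulled back, so the new plane rotation acts before the
      rotation \<open>Q\<close> of the tail.\<close>
    let ?P = "(rot \<phi> \<oplus> Id j) ;; (Id 1 \<oplus> Q)"
    note [simp] = realizes_typed[OF rot_realizes] realizes_typed[OF Q(1)]
    have a: "realizes (rot \<phi> \<oplus> Id j) (Suc k) (Suc k) (\<lambda>x. ?R (take 2 x) @ drop 2 x)"
      using realizes_par[OF rot_realizes realizes_Id] by (simp add: Suc)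
    have b: "realizes (Id 1 \<oplus> Q) (Suc k) (Suc k) (\<lambda>x. take 1 x @ q (drop 1 x))"
      using realizes_par[OF realizes_Id[of 1] Q(1)] by simp
    have 1: "realizes ?P (Suc k) (Suc k) ?q"
      by (rule realizes_cong[OF realizes_seq[OF a b]]) (simp add: Suc)
    have 2: "affine_map (Suc k) (Suc k) ?q"
    proof (intro affine_map_Cons affine_map_comp[OF Q(2)])
      show "affine_map (Suc k) k (\<lambda>x. (sin \<phi> * x ! 0 + cos \<phi> * x ! 1) # drop 2 x)"
        unfolding Suc by (intro affine_map_Cons affine_fun_add affine_fun_scale affine_fun_nth
            affine_map_drop[OF affine_map_id]) auto
      show "affine_fun (Suc k) (\<lambda>x. cos \<phi> * x ! 0 - sin \<phi> * x ! 1)"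
        unfolding Suc by (intro affine_fun_diff affine_fun_scale affine_fun_nth) auto
    qed
    have "Npow (Suc k) ;; ?P \<doteq> (Npow (Suc k) ;; (rot \<phi> \<oplus> Id j)) ;; (Id 1 \<oplus> Q)"
      by (intro gqa_eq.symm[OF gqa_eq.seq_assoc]) (auto simp: Suc)
    also have "\<dots> \<doteq> Npow (Suc k) ;; (Id 1 \<oplus> Q)"
      using Npow_rot[OF \<phi>, of j] by (intro cong_seq_left) (auto simp: Suc)
    also have "\<dots> \<doteq> (Gen NGen ;; Id 1) \<oplus> (Npow k ;; Q)"
      by (intro Npow_Suc_seq_par) auto
    also have "\<dots> \<doteq> Gen NGen \<oplus> Npow k"
      using gqa_eq.seq_id_right[of "Gen NGen"] Q(3) by (intro gqa_eq.cong_par) auto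
    finally have 3: "Npow (Suc k) ;; ?P \<doteq> Npow (Suc k)" by simp
    have 4: "g (?q x) = (case x of [] \<Rightarrow> \<gamma> | a # _ \<Rightarrow> s * a + \<gamma>)" if x: "length x = Suc k" for x
    proof -
      from x Suc obtain x0 x1 xs where xs: "x = x0 # x1 # xs" "length xs = j"
        by (auto simp: length_Suc_conv)
      let ?y = "(sin \<phi> * x0 + cos \<phi> * x1) # xs"
      have "length (q ?y) = k" using Q(2) xs Suc by (simp add: affine_map_def)
      then have "g (?q x) = a * (cos \<phi> * x0 - sin \<phi> * x1) + (r * (sin \<phi> * x0 + cos \<phi> * x1) + \<gamma>)"
        using xs Suc hq[of ?y] by (simp add: h)
      also have "\<dots> = s * x0 * ((sin \<phi>)\<^sup>2 + (cos \<phi>)\<^sup>2) + \<gamma>"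
        unfolding as rs by (simp add: algebra_simps power2_eq_square 
          del: sin_cos_squared_add sin_cos_squared_add2 sin_cos_squared_add3)
      finally show ?thesis by (simp add: xs)
    qed
    show ?thesis using 1 2 3 4 by blast
  qed
qed

section \<open>Scalars\<close>

text \<open>The constant stands to the left of the tested wire, so that sliding a Gaussian past it
  produces exactly the shape of \<open>N_op\<close>.\<close>

definition point_test :: "real \<Rightarrow> gen diag" where
  "point_test c = ((Gen One ;; Gen (Scalar c)) \<oplus> Id 1) ;; (Gen BMult ;; Gen Discard)"

lemma point_test_typed [simp]:
  "wf_diag (point_test c)" "src (point_test c) = 1" "tgt (point_test c) = 0"
  "NGen \<notin> gens (point_test c)"
  by (auto simp: point_test_def)

lemma rel_point_test [simp]: "rel (point_test c) [x] [] \<longleftrightarrow> x = c"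
proof -
  let ?P = "(Gen One ;; Gen (Scalar c)) \<oplus> Id 1"
  have "realizes ?P 1 2 (\<lambda>x. c # x)"
    using realizes_par[OF realizes_const[of c] realizes_Id[of 1]] by (simp add: numeral_2_eq_2)
  then have "rel (point_test c) [x] [] \<longleftrightarrow> rel (Gen BMult ;; Gen Discard) [c, x] []"
    unfolding point_test_def by (subst rel_realizes_seq) auto
  also have "\<dots> \<longleftrightarrow> (\<exists>y. length y = 1 \<and> c = y ! 0 \<and> x = y ! 0)"
    by simp
  also have "\<dots> \<longleftrightarrow> x = c"
    by (auto intro: exI[of _ "[c]"])
  finally show ?thesis .
qed

definition std_scalar :: "gen diag \<Rightarrow> bool" where
  "std_scalar \<alpha> \<longleftrightarrow> (\<exists>c\<ge>0. \<alpha> = Gen One ;; Gen (Scalar c) ;; N_op) \<or> \<alpha> = Gen One ;; Gen WCounit"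

lemma std_scalar_typed: "std_scalar \<alpha> \<Longrightarrow> wf_diag \<alpha> \<and> src \<alpha> = 0 \<and> tgt \<alpha> = 0"
  by (auto simp: std_scalar_def N_op_def)

text \<open>The constant and the Gaussian are both states, so either may come first: testing the
  Gaussian at \<open>c\<close> is the same as feeding \<open>c\<close> into
  \<open>N_op\<close>.\<close>

lemma N_point_test: "Gen NGen ;; point_test c \<doteq> Gen One ;; Gen (Scalar c) ;; N_op"
proof -
  let ?O = "Gen One ;; Gen (Scalar c)" and ?N = "Gen NGen"
  have "?N ;; point_test c \<doteq> (?N ;; (?O \<oplus> Id 1)) ;; (Gen BMult ;; Gen Discard)"
    unfolding point_test_def by (intro gqa_eq.symm[OF gqa_eq.seq_assoc]) auto
  also have "\<dots> \<doteq> (?O ;; (Id 1 \<oplus> ?N)) ;; (Gen BMult ;; Gen Discard)"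
  proof (intro cong_seq_left)
    have "?N ;; (?O \<oplus> Id 1) \<doteq> (?O \<oplus> Id 0) ;; (Id 1 \<oplus> ?N)"
      using state_par_seq[of ?O ?N] by simp
    also have "\<dots> \<doteq> ?O ;; (Id 1 \<oplus> ?N)"
      by (intro cong_seq_left gqa_eq.par_unit_right) auto
    finally show "?N ;; (?O \<oplus> Id 1) \<doteq> ?O ;; (Id 1 \<oplus> ?N)" .
  qed auto
  also have "\<dots> \<doteq> ?O ;; ((Id 1 \<oplus> ?N) ;; (Gen BMult ;; Gen Discard))"
    by (intro gqa_eq.seq_assoc) auto
  also have "\<dots> \<doteq> ?O ;; N_op"
    unfolding N_op_def by (intro cong_seq_right gqa_eq.symm[OF gqa_eq.seq_assoc]) auto
  finally show ?thesis .
qed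

text \<open>The test at 0 denotes the same relation as \<open>WCounit\<close>, so axiom
  \<open>Z\<close> applies. It follows that the empty diagram is the standard scalar with constant
  0.\<close>

lemma N_point_test_0: "Gen NGen ;; point_test 0 \<doteq> Id 0"
proof -
  have "point_test 0 \<doteq> Gen WCounit"
    by (rule affine_diags_eqI[of _ 1 0])
      (auto simp: affine_diags_def diags_def length_1_conv)
  then have "Gen NGen ;; point_test 0 \<doteq> Gen NGen ;; Gen WCounit"
    by (intro cong_seq_right) auto
  also have "\<dots> \<doteq> Id 0" by (rule gqa_eq.Z)
  finally show ?thesis .
qed

lemma zero_scalar: "Gen One ;; Gen (Scalar 0) ;; N_op \<doteq> Id 0"
  by (rule gqa_eq.trans[OF gqa_eq.symm[OF N_point_test] N_point_test_0])

text \<open>After the rotation the second Gaussian is tested at 0 and disappears by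
  \<open>N_point_test_0\<close>.\<close>

lemma N_point_test_par:
  "\<exists>r\<ge>0. (Gen NGen ;; point_test a) \<oplus> (Gen NGen ;; point_test b) \<doteq> Gen NGen ;; point_test r"
proof -
  obtain \<phi> r where \<phi>: "0 \<le> \<phi>" "\<phi> < 2 * pi" and r: "0 \<le> r"
    and a: "a = r * cos \<phi>" and b: "b = r * sin \<phi>"
    using ex_angle by blast
  note [simp] = realizes_typed[OF rot_realizes]
  let ?N = "Gen NGen"
  \<comment> \<open>Passing both tests after the rotation means that the input is the preimage of
    \<open>(a, b)\<close>, which is \<open>(r, 0)\<close>.\<close>
  have *: "rot \<phi> ;; (point_test a \<oplus> point_test b) \<doteq> point_test r \<oplus> point_test 0"
  proof (rule affine_diags_eqI[of _ 2 0])
    fix x y :: "real list" assume "length x = 2" "length y = 0"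
    then obtain x0 x1 where x: "x = [x0, x1]" "y = []"
      by (auto simp: numeral_2_eq_2 length_2_conv)
    let ?R = "[cos \<phi> * x0 - sin \<phi> * x1, sin \<phi> * x0 + cos \<phi> * x1]"
    have "rel (rot \<phi> ;; (point_test a \<oplus> point_test b)) x y \<longleftrightarrow>
        rel (point_test a \<oplus> point_test b) ?R []"
      using rel_realizes_seq[OF rot_realizes, of x] by (simp add: x del: rel.simps)
    also have "\<dots> \<longleftrightarrow> cos \<phi> * x0 - sin \<phi> * x1 = a \<and> sin \<phi> * x0 + cos \<phi> * x1 = b"
      by simp
    also have "\<dots> \<longleftrightarrow> x0 = r \<and> x1 = 0"
    proof
      assume *: "cos \<phi> * x0 - sin \<phi> * x1 = a \<and> sin \<phi> * x0 + cos \<phi> * x1 = b"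
      then have "cos \<phi> * x0 - sin \<phi> * x1 = r * cos \<phi>" "sin \<phi> * x0 + cos \<phi> * x1 = r * sin \<phi>"
        by (simp_all add: a b)
      with sin_cos_squared_add[of \<phi>] show "x0 = r \<and> x1 = 0" by algebra
    qed (auto simp: a b)
    finally show "rel (rot \<phi> ;; (point_test a \<oplus> point_test b)) x y \<longleftrightarrow>
        rel (point_test r \<oplus> point_test 0) x y"
      by (simp add: x)
  qed (auto simp: affine_diags_def diags_def)
  have "(?N ;; point_test a) \<oplus> (?N ;; point_test b) \<doteq> (?N \<oplus> ?N) ;; (point_test a \<oplus> point_test b)"
    by (intro gqa_eq.interchange) auto
  also have "\<dots> \<doteq> ((?N \<oplus> ?N) ;; rot \<phi>) ;; (point_test a \<oplus> point_test b)"
    using gqa_eq.symm[OF gqa_eq.RI[OF \<phi>]] by (intro cong_seq_left) auto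
  also have "\<dots> \<doteq> (?N \<oplus> ?N) ;; (rot \<phi> ;; (point_test a \<oplus> point_test b))"
    by (intro gqa_eq.seq_assoc) auto
  also have "\<dots> \<doteq> (?N \<oplus> ?N) ;; (point_test r \<oplus> point_test 0)"
    using * by (intro cong_seq_right) auto
  also have "\<dots> \<doteq> (?N ;; point_test r) \<oplus> (?N ;; point_test 0)"
    by (intro gqa_eq.symm[OF gqa_eq.interchange]) auto
  also have "\<dots> \<doteq> (?N ;; point_test r) \<oplus> Id 0"
    by (intro cong_par_right N_point_test_0) auto
  also have "\<dots> \<doteq> ?N ;; point_test r"
    by (intro gqa_eq.par_unit_right) auto
  finally show ?thesis using r by blast
qed

lemma state_par_scalar:
  assumes "wf_diag a" "src a = 0" "wf_diag f" "src f = tgt a" "wf_diag \<alpha>" "src \<alpha> = 0"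
  shows "a ;; (f \<oplus> \<alpha>) \<doteq> (a ;; f) \<oplus> \<alpha>"
proof -
  have "a ;; (f \<oplus> \<alpha>) \<doteq> (a \<oplus> Id 0) ;; (f \<oplus> \<alpha>)"
    using assms by (intro cong_seq_left gqa_eq.symm[OF gqa_eq.par_unit_right]) auto
  also have "\<dots> \<doteq> (a ;; f) \<oplus> (Id 0 ;; \<alpha>)"
    using assms by (intro gqa_eq.symm[OF gqa_eq.interchange]) auto
  also have "\<dots> \<doteq> (a ;; f) \<oplus> \<alpha>"
    using assms gqa_eq.seq_id_left[of \<alpha>] by (intro cong_par_right) auto
  finally show ?thesis .
qed

text \<open>Finite scalars fuse by \<open>N_point_test_par\<close>. The scalar \<infinity> swallows
  the test: beside a contradiction, one test may be exchanged for another, here one that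
  \<open>Z\<close> removes.\<close>

lemma std_scalar_absorb:
  assumes "std_scalar \<alpha>"
  shows "\<exists>\<beta>. std_scalar \<beta> \<and> (Gen NGen ;; point_test c) \<oplus> \<alpha> \<doteq> \<beta>"
  using assms unfolding std_scalar_def[of \<alpha>]
proof (elim disjE exE conjE)
  fix b :: real assume \<alpha>: "\<alpha> = Gen One ;; Gen (Scalar b) ;; N_op"
  obtain r where r: "r \<ge> 0"
    "(Gen NGen ;; point_test c) \<oplus> (Gen NGen ;; point_test b) \<doteq> Gen NGen ;; point_test r"
    using N_point_test_par by blast
  have "(Gen NGen ;; point_test c) \<oplus> \<alpha> \<doteq> (Gen NGen ;; point_test c) \<oplus> (Gen NGen ;; point_test b)"
    unfolding \<alpha> by (intro cong_par_right gqa_eq.symm[OF N_point_test]) auto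
  also note r(2)
  also have "Gen NGen ;; point_test r \<doteq> Gen One ;; Gen (Scalar r) ;; N_op"
    by (rule N_point_test)
  finally show ?thesis using r(1) by (auto simp: std_scalar_def)
next
  let ?N = "Gen NGen"
  assume \<alpha>: "\<alpha> = Gen One ;; Gen WCounit"
  have *: "rel \<alpha> [] [] \<longleftrightarrow> False" "wf_diag \<alpha>" "src \<alpha> = 0" "tgt \<alpha> = 0" "NGen \<notin> gens \<alpha>"
    by (auto simp: \<alpha>)
  have "(?N ;; point_test c) \<oplus> \<alpha> \<doteq> ?N ;; (point_test c \<oplus> \<alpha>)"
    using * by (intro gqa_eq.symm[OF state_par_scalar]) auto
  \<comment> \<open>Both affine parts denote the empty relation, so axiom \<open>E\<close>
    identifies them.\<close>
  also have "\<dots> \<doteq> ?N ;; (Gen WCounit \<oplus> \<alpha>)"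
    using * by (intro cong_seq_right affine_diags_eqI[of _ 1 0])
      (auto simp: affine_diags_def diags_def)
  also have "\<dots> \<doteq> (?N ;; Gen WCounit) \<oplus> \<alpha>"
    using * by (intro state_par_scalar) auto
  also have "\<dots> \<doteq> Id 0 \<oplus> \<alpha>"
    using * by (intro cong_par_left gqa_eq.Z) auto
  also have "\<dots> \<doteq> \<alpha>"
    using * by (intro gqa_eq.par_unit_left) auto
  finally show ?thesis using assms by blast
qed


section \<open>Normal forms\<close>

definition has_normal_form :: "gen diag \<Rightarrow> nat \<Rightarrow> bool" where
  "has_normal_form d n \<longleftrightarrow> (\<exists>M \<alpha>. M \<in> diags 0 n \<and> gens M \<subseteq> GQA_E_gens \<and> std_scalar \<alpha> \<and> d \<doteq> M \<oplus> \<alpha>)"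

lemma has_normal_form_cong: "d \<doteq> d' \<Longrightarrow> has_normal_form d' n \<Longrightarrow> has_normal_form d n"
  unfolding has_normal_form_def by (meson gqa_eq.trans)

text \<open>The mandatory scalar is supplied by \<open>zero_scalar\<close>, with constant 0.\<close>

lemma has_normal_form_directed:
  assumes "M \<in> diags 0 n" "gens M \<subseteq> GQA_E_gens"
  shows "has_normal_form M n"
proof -
  have "M \<doteq> M \<oplus> Id 0"
    using assms by (intro gqa_eq.symm[OF gqa_eq.par_unit_right]) (auto simp: diags_def)
  also have "\<dots> \<doteq> M \<oplus> (Gen One ;; Gen (Scalar 0) ;; N_op)"
    using assms by (intro cong_par_right gqa_eq.symm[OF zero_scalar]) (auto simp: diags_def)
  finally show ?thesis
    using assms unfolding has_normal_form_def std_scalar_def by blast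
qed

text \<open>As a scalar, the tested Gaussian commutes past \<open>M\<close> and is then absorbed by
  \<open>\<alpha>\<close>.\<close>

lemma has_normal_form_par_point_test:
  assumes "has_normal_form d n"
  shows "has_normal_form ((Gen NGen ;; point_test c) \<oplus> d) n"
proof -
  let ?\<pi> = "Gen NGen ;; point_test c"
  obtain M \<alpha> where M: "M \<in> diags 0 n" "gens M \<subseteq> GQA_E_gens" and \<alpha>: "std_scalar \<alpha>"
    and d: "d \<doteq> M \<oplus> \<alpha>"
    using assms unfolding has_normal_form_def by blast
  obtain \<beta> where \<beta>: "std_scalar \<beta>" "?\<pi> \<oplus> \<alpha> \<doteq> \<beta>"
    using std_scalar_absorb[OF \<alpha>] by blast
  note [simp] = std_scalar_typed[OF \<alpha>]
  have wf [simp]: "wf_diag M" using M by (auto simp: diags_def)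
  have "?\<pi> \<oplus> d \<doteq> ?\<pi> \<oplus> (M \<oplus> \<alpha>)"
    using d by (intro cong_par_right) auto
  also have "\<dots> \<doteq> (?\<pi> \<oplus> M) \<oplus> \<alpha>"
    by (intro gqa_eq.symm[OF gqa_eq.par_assoc]) auto
  also have "\<dots> \<doteq> (M \<oplus> ?\<pi>) \<oplus> \<alpha>"
    using M by (intro cong_par_left scalar_par_commute) (auto simp: diags_def)
  also have "\<dots> \<doteq> M \<oplus> (?\<pi> \<oplus> \<alpha>)"
    by (intro gqa_eq.par_assoc) auto
  also have "\<dots> \<doteq> M \<oplus> \<beta>"
    using \<beta> by (intro cong_par_right) auto
  finally show ?thesis
    using M \<beta>(1) unfolding has_normal_form_def by blast
qed

section \<open>Operations on presentations: substitution, elimination and removal of void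
  equations\<close>

lemma presents_equations:
  assumes "presents s m n e F fs" "length x = m" "length z = n" "rel s x z"
  shows "\<exists>y. length y = e \<and> (\<forall>f\<in>set fs. f (y @ x) = 0)"
  using assms unfolding presents_def by blast

text \<open>Substitution for the inputs alone keeps the hidden variables and the number of
  equations. It serves both the rotation and the pinning of an input to a constant.\<close>

lemma presents_precomp:
  assumes s: "presents s k n e F fs" and Q: "realizes Q j k q" "affine_map j k q"
  shows "presents (Q ;; s) j n e (\<lambda>v. F (take e v @ q (drop e v)))
    (map (\<lambda>f v. f (take e v @ q (drop e v))) fs)"
proof (rule presentsI)
  have \<sigma>: "affine_map (e + j) (e + k) (\<lambda>v. take e v @ q (drop e v))"
  proof (rule affine_map_append)
    show "affine_map (e + j) e (take e)" by (rule affine_map_take[OF affine_map_id]) auto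
    show "affine_map (e + j) k (\<lambda>v. q (drop e v))"
      by (rule affine_map_comp[OF Q(2) affine_map_drop[OF affine_map_id]]) auto
  qed auto
  show "affine_map (e + j) n (\<lambda>v. F (take e v @ q (drop e v)))"
    using s by (intro affine_map_comp[OF _ \<sigma>]) (auto simp: presents_def)
  show "affine_fun (e + j) f" if "f \<in> set (map (\<lambda>f v. f (take e v @ q (drop e v))) fs)" for f
    using that s affine_fun_comp[OF _ \<sigma>] by (auto simp: presents_def)
  fix x z :: "real list" assume x: "length x = j" and z: "length z = n"
  have "rel (Q ;; s) x z \<longleftrightarrow> rel s (q x) z"
    by (rule rel_realizes_seq[OF Q(1) x])
  also have "\<dots> \<longleftrightarrow> (\<exists>y. length y = e \<and> z = F (y @ q x) \<and> (\<forall>f\<in>set fs. f (y @ q x) = 0))"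
    using s z x affine_map_length[OF Q(2) x] by (simp add: presents_def)
  also have "\<dots> \<longleftrightarrow> (\<exists>y. length y = e \<and> z = F (take e (y @ x) @ q (drop e (y @ x))) \<and>
      (\<forall>f\<in>set (map (\<lambda>f v. f (take e v @ q (drop e v))) fs). f (y @ x) = 0))"
    by (intro ex_cong1) auto
  finally show "rel (Q ;; s) x z \<longleftrightarrow> \<dots>" .
qed

text \<open>The solutions of the head equation are reparametrized by \<open>\<sigma>\<close>;
  substituting them into \<open>F\<close> and \<open>fs\<close> discharges that equation.\<close>

lemma presents_solve:
  assumes s: "presents s k n e F (f # fs)" and \<sigma>: "affine_map (e' + k) e \<sigma>"
    and sol: "\<And>x. length x = k \<Longrightarrow>
       {y. length y = e \<and> f (y @ x) = 0} = (\<lambda>y'. \<sigma> (y' @ x)) ` {y'. length y' = e'}"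
  shows "presents s k n e' (\<lambda>v. F (\<sigma> v @ drop e' v)) (map (\<lambda>f v. f (\<sigma> v @ drop e' v)) fs)"
proof (rule presentsI)
  have \<tau>: "affine_map (e' + k) (e + k) (\<lambda>v. \<sigma> v @ drop e' v)"
    by (rule affine_map_append[OF \<sigma> affine_map_drop[OF affine_map_id]]) auto
  show "affine_map (e' + k) n (\<lambda>v. F (\<sigma> v @ drop e' v))"
    using s by (intro affine_map_comp[OF _ \<tau>]) (auto simp: presents_def)
  show "affine_fun (e' + k) f" if "f \<in> set (map (\<lambda>f v. f (\<sigma> v @ drop e' v)) fs)" for f
    using that s affine_fun_comp[OF _ \<tau>] by (auto simp: presents_def)
  fix x z :: "real list" assume x: "length x = k" and z: "length z = n"
  have "rel s x z \<longleftrightarrow> (\<exists>y \<in> {y. length y = e \<and> f (y @ x) = 0}.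
      z = F (y @ x) \<and> (\<forall>f\<in>set fs. f (y @ x) = 0))"
    using s x z by (auto simp: presents_def)
  also have "\<dots> \<longleftrightarrow> (\<exists>y. length y = e' \<and> z = F (\<sigma> (y @ x) @ drop e' (y @ x)) \<and>
      (\<forall>f\<in>set (map (\<lambda>f v. f (\<sigma> v @ drop e' v)) fs). f (y @ x) = 0))"
    unfolding sol[OF x] by auto
  finally show "rel s x z \<longleftrightarrow> \<dots>" .
qed

lemma presents_trivial:
  assumes "presents s k n e F (f # fs)"
    and "\<And>x y. length x = k \<Longrightarrow> length y = e \<Longrightarrow> f (y @ x) = 0"
  shows "presents s k n e F fs"
  using assms unfolding presents_def by (auto 0 4)

text \<open>Each round removes the head equation but rewrites the others by a substitution, so the
  induction is on the length of the list and leaves \<open>s\<close>, \<open>k\<close>,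
  \<open>e\<close> and \<open>F\<close> free.\<close>

lemma presented_normal_form:
  "presents s k n e F fs \<Longrightarrow> s \<in> affine_diags k n \<Longrightarrow> has_normal_form (Npow k ;; s) n"
proof (induction fs arbitrary: s k e F rule: length_induct)
  case (1 fs s k e F)
  note IH = 1(1)[rule_format] and s = 1(2,3)
  have [simp]: "wf_diag s" "src s = k" "tgt s = n" "NGen \<notin> gens s"
    using s by (auto simp: affine_diags_def diags_def)
  show ?case
  proof (cases fs)
    case Nil
    obtain t where t: "realizes t (e + k) n F"
      using s(1) ex_realizes_affine_map[of "e + k" n F] by (auto simp: presents_def)
    note [simp] = realizes_typed[OF t]
    have "s \<doteq> (BUnits e \<oplus> Id k) ;; t"
    proof (rule affine_diags_eqI[OF s(2)])
      fix x z :: "real list" assume x: "length x = k" and z: "length z = n"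
      have "rel ((BUnits e \<oplus> Id k) ;; t) x z
          \<longleftrightarrow> (\<exists>y. length y = e + k \<and> drop e y = x \<and> rel t y z)"
      proof -
        have "rel (BUnits e \<oplus> Id k) x y \<longleftrightarrow> drop e y = x" if "length y = e + k" for y
          using that rel_BUnits[of "take e y" e] by simp
        moreover have "tgt (BUnits e \<oplus> Id k) = e + k" by simp
        ultimately show ?thesis unfolding rel.simps(4) by metis
      qed
      also have "\<dots> \<longleftrightarrow> (\<exists>y. length y = e + k \<and> drop e y = x \<and> z = F y)"
        using t z by (intro ex_cong1) (auto simp: realizes_def)
      also have "\<dots> \<longleftrightarrow> (\<exists>y. length y = e \<and> z = F (y @ x))" (is "?L \<longleftrightarrow> ?R")
      proof
        assume ?L
        then obtain y where "length y = e + k" "drop e y = x" "z = F y" by blast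
        then show ?R using append_take_drop_id[of e y] by (intro exI[of _ "take e y"]) simp
      next
        assume ?R
        then obtain y where "length y = e" "z = F (y @ x)" by blast
        then show ?L using x by (intro exI[of _ "y @ x"]) simp
      qed
      finally show "rel s x z \<longleftrightarrow> rel ((BUnits e \<oplus> Id k) ;; t) x z"
        using s(1) x z Nil by (simp add: presents_def)
    qed (auto simp: affine_diags_def diags_def)
    then have "Npow k ;; s \<doteq> Npow k ;; ((BUnits e \<oplus> Id k) ;; t)"
      by (intro cong_seq_right) auto
    moreover have "has_normal_form (Npow k ;; ((BUnits e \<oplus> Id k) ;; t)) n"
      by (intro has_normal_form_directed) (auto simp: diags_def)
    ultimately show ?thesis by (rule has_normal_form_cong)
  next
    case (Cons f fs')
    then have "affine_fun (e + k) f" using s(1) by (simp add: presents_def)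
    from affine_equation_cases[OF this] show ?thesis
    proof (elim disjE exE conjE)
      fix e' \<sigma> assume "e = Suc e'" and \<sigma>: "affine_map (e' + k) e \<sigma>" and "\<forall>x. length x = k \<longrightarrow>
         {y. length y = e \<and> f (y @ x) = 0} = (\<lambda>y'. \<sigma> (y' @ x)) ` {y'. length y' = e'}"
      then have "presents s k n e' (\<lambda>v. F (\<sigma> v @ drop e' v)) (map (\<lambda>f v. f (\<sigma> v @ drop e' v)) fs')"
        using s(1) unfolding Cons by (intro presents_solve) auto
      then show ?thesis using s(2) Cons by (intro IH) auto
    next
      fix g assume g: "affine_fun k g"
        "\<forall>x y. length x = k \<longrightarrow> length y = e \<longrightarrow> f (y @ x) = g x"
      \<comment> \<open>The equation constrains the Gaussian wires only; they absorb
        \<open>Q\<close>, so \<open>Q ;; s\<close> may replace \<open>s\<close>.\<close>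
      obtain Q q r \<gamma> where Q: "realizes Q k k q" "affine_map k k q" "Npow k ;; Q \<doteq> Npow k"
        and gq: "\<And>x. length x = k \<Longrightarrow> g (q x) = (case x of [] \<Rightarrow> \<gamma> | a # _ \<Rightarrow> r * a + \<gamma>)"
        using rotate_functional[OF g(1)] by blast
      note [simp] = realizes_typed[OF Q(1)]
      let ?\<tau> = "\<lambda>v. take e v @ q (drop e v)"
      have s1: "presents (Q ;; s) k n e (\<lambda>v. F (?\<tau> v)) ((\<lambda>v. f (?\<tau> v)) # map (\<lambda>f v. f (?\<tau> v)) fs')"
        using presents_precomp[OF s(1) Q(1,2)] Cons by simp
      have s1': "Q ;; s \<in> affine_diags k n" by (auto simp: affine_diags_def diags_def)
      have f: "f (?\<tau> (y @ x)) = (case x of [] \<Rightarrow> \<gamma> | a # _ \<Rightarrow> r * a + \<gamma>)"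
        if "length x = k" "length y = e" for x y
        using that g(2) affine_map_length[OF Q(2)] gq by simp
      have "Npow k ;; s \<doteq> (Npow k ;; Q) ;; s"
        using gqa_eq.symm[OF Q(3)] by (intro cong_seq_left) auto
      also have "\<dots> \<doteq> Npow k ;; (Q ;; s)"
        by (intro gqa_eq.seq_assoc) auto
      finally show ?thesis
      proof (rule has_normal_form_cong)
        show "has_normal_form (Npow k ;; (Q ;; s)) n"
        \<comment> \<open>In either case the rotated equation reads \<open>\<gamma> = 0\<close> and
          mentions no variable.\<close>
        proof (cases "k = 0 \<or> r = 0")
          case True
          then have f: "f (?\<tau> (y @ x)) = \<gamma>" if "length x = k" "length y = e" for x y
            using f[OF that] that by (auto split: list.splits)
          show ?thesis
          proof (cases "\<gamma> = 0")
            case True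
            have "presents (Q ;; s) k n e (\<lambda>v. F (?\<tau> v)) (map (\<lambda>f v. f (?\<tau> v)) fs')"
              by (rule presents_trivial[OF s1]) (use f True in auto)
            then show ?thesis using Cons s1' by (intro IH) auto
          next
            case False
            obtain t where t: "realizes t k 0 (\<lambda>x. [])" using ex_realizes_discard by blast
            note [simp] = realizes_typed[OF t]
            \<comment> \<open>The relation is empty. Beside the scalar \<infinity> any directed
              affine diagram of the right type does; this one discards its inputs and emits
              arbitrary values.\<close>
            let ?\<alpha> = "Gen One ;; Gen WCounit" and ?t = "t ;; BUnits n"
            have "\<not> rel (Q ;; s) x z" if "length x = k" "length z = n" for x z
              using presents_equations[OF s1 that] that(1) f False by fastforce
            moreover have "\<not> rel (?t \<oplus> ?\<alpha>) x z" for x z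
              by auto
            ultimately have "Q ;; s \<doteq> ?t \<oplus> ?\<alpha>"
              using s1' by (intro affine_diags_eqI[of _ k n]) (auto simp: affine_diags_def diags_def)
            then have "Npow k ;; (Q ;; s) \<doteq> Npow k ;; (?t \<oplus> ?\<alpha>)"
              by (intro cong_seq_right) auto
            also have "\<dots> \<doteq> (Npow k ;; ?t) \<oplus> ?\<alpha>"
              by (intro state_par_scalar) auto
            finally show ?thesis
              unfolding has_normal_form_def std_scalar_def
              by (intro exI[of _ "Npow k ;; ?t"] exI[of _ ?\<alpha>]) (auto simp: diags_def)
          qed
        next
          case False
          then obtain k' where k: "k = Suc k'" and r: "r \<noteq> 0" by (cases k) auto
          \<comment> \<open>The root of \<open>r * a + \<gamma>\<close> in \<open>a\<close>.\<close>
          define c where "c = - \<gamma> / r"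
          let ?O = "Gen One ;; Gen (Scalar c)"
          let ?P = "?O \<oplus> Id k'" and ?cons = "\<lambda>x. c # x"
          \<comment> \<open>The slice of the relation at first input \<open>c\<close>, fed by the
            other \<open>k'\<close> Gaussians.\<close>
          let ?s2 = "?P ;; (Q ;; s)"
          have P: "realizes ?P k' k ?cons"
            using realizes_par[OF realizes_const[of c] realizes_Id[of k']] by (simp add: k)
          have cons: "affine_map k' k ?cons"
            unfolding k by (intro affine_map_Cons affine_fun_const affine_map_id)
          let ?\<upsilon> = "\<lambda>v. take e v @ ?cons (drop e v)"
          have "presents ?s2 k' n e (\<lambda>v. F (?\<tau> (?\<upsilon> v)))
              ((\<lambda>v. f (?\<tau> (?\<upsilon> v))) # map (\<lambda>f v. f (?\<tau> (?\<upsilon> v))) fs')"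
            using presents_precomp[OF s1 P cons] by (simp add: comp_def)
          \<comment> \<open>On the slice the head equation reads \<open>r * c + \<gamma> = 0\<close>
            and is void, so the induction hypothesis applies to the remaining equations.\<close>
          then have "presents ?s2 k' n e (\<lambda>v. F (?\<tau> (?\<upsilon> v))) (map (\<lambda>f v. f (?\<tau> (?\<upsilon> v))) fs')"
            by (rule presents_trivial) (use f[of "c # _"] r k in \<open>auto simp: c_def\<close>)
          then have nf: "has_normal_form (Npow k' ;; ?s2) n"
            using Cons by (intro IH) (auto simp: affine_diags_def diags_def k)
          \<comment> \<open>The head equation forces the first input to be \<open>c\<close>; the
            relation is therefore that test in parallel with the slice.\<close>
          have "Q ;; s \<doteq> point_test c \<oplus> ?s2"
          proof (rule affine_diags_eqI[OF s1'])
            fix x z :: "real list" assume lx: "length x = k" and z: "length z = n"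
            from lx obtain a x' where x: "x = a # x'" "length x' = k'" by (auto simp: k length_Suc_conv)
            have "rel ?s2 x' z \<longleftrightarrow> rel (Q ;; s) (c # x') z"
              by (rule rel_realizes_seq[OF P x(2)])
            moreover have "a = c" if rel: "rel (Q ;; s) x z"
            proof -
              obtain y where "length y = e" "f (?\<tau> (y @ x)) = 0"
                using presents_equations[OF s1 lx z rel] by auto
              then have "r * a + \<gamma> = 0" using f[of x y] x k by simp
              then show "a = c" using r by (simp add: c_def field_simps)
            qed
            moreover have "rel (point_test c \<oplus> ?s2) x z \<longleftrightarrow> a = c \<and> rel ?s2 x' z"
              using x by (simp del: rel.simps(4))
            ultimately show "rel (Q ;; s) x z \<longleftrightarrow> rel (point_test c \<oplus> ?s2) x z"
              using x by blast
          qed (auto simp: affine_diags_def diags_def k)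
          then have "Npow k ;; (Q ;; s) \<doteq> Npow k ;; (point_test c \<oplus> ?s2)"
            by (intro cong_seq_right) auto
          also have "\<dots> \<doteq> (Gen NGen ;; point_test c) \<oplus> (Npow k' ;; ?s2)"
            unfolding k by (intro Npow_Suc_seq_par) (auto simp: k)
          finally show ?thesis
            using has_normal_form_par_point_test[OF nf] by (rule has_normal_form_cong)
        qed
      qed
    qed
  qed
qed

theorem theorem2:
  fixes M :: "gen diag" and n :: nat
  assumes "M \<in> diags 0 n"
  shows "\<exists>M' \<alpha>. M' \<in> diags 0 n \<and> gens M' \<subseteq> GQA_E_gens \<and> \<alpha> \<in> diags 0 0 \<and>
    ((\<exists>c::real. c \<ge> 0 \<and> \<alpha> = Gen One ;; Gen (Scalar c) ;; N_op) \<or>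
      \<alpha> = Gen One ;; Gen WCounit) \<and>
    M \<doteq> M' \<oplus> \<alpha>"
proof -
  have M: "wf_diag M" "src M = 0" "tgt M = n" using assms by (auto simp: diags_def)
  \<comment> \<open>Since \<open>M\<close> has no inputs, only Gaussians feed the affine
    part.\<close>
  obtain k s where s: "s \<in> affine_diags k n" and Ms: "M \<doteq> (Npow k \<oplus> Id 0) ;; s"
    using Npow_form[OF M(1)] M by auto
  have ws: "wf_diag s" "src s = k" "tgt s = n" "NGen \<notin> gens s"
    using s by (auto simp: affine_diags_def diags_def)
  note Ms
  also have "(Npow k \<oplus> Id 0) ;; s \<doteq> Npow k ;; s"
    using ws by (intro cong_seq_left gqa_eq.par_unit_right) auto
  finally have "M \<doteq> Npow k ;; s" .
  moreover obtain e F fs where "presents s k n e F fs"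
    using affine_presentation[OF ws(1,4)] ws by auto
  ultimately have "has_normal_form M n"
    using presented_normal_form s has_normal_form_cong by blast
  then obtain M' \<alpha> where "M' \<in> diags 0 n" "gens M' \<subseteq> GQA_E_gens" "std_scalar \<alpha>" "M \<doteq> M' \<oplus> \<alpha>"
    unfolding has_normal_form_def by blast
  then show ?thesis
    using std_scalar_typed[of \<alpha>] unfolding std_scalar_def diags_def by blast
qed

end
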